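(* Let $\mathbb{K}$ be a field and let $G$ be a digraph. There exists a basis of the $\mathbb{K}$-vector space $\Omega_3(G)$ consisting of trapezohedral paths $\tau_m$ with $m\ge 2$ and their merging images. Moreover, there is an algorithm which, given a finite digraph $G$ with vertex set $V$, determines the dimension and a basis of $\Omega_3(G)$ with time complexity $O(|V|^5)$.
   Context: A digraph is a pair $G=(V,E)$ with $E\subset (V\times V)\setminus\mathrm{diag}$; write $i\to j$ if $(i,j)\in E$. Fix a field $\mathbb{K}$. An elementary $p$-path is a sequence $i_0,\dots,i_p$ of vertices (repetitions allowed), written $e_{i_0\dots i_p}$; $\Lambda_p$ is the $\mathbb{K}$-vector space with basis all elementary $p$-paths. The boundary is $\partial e_{i_0\dots i_p}=\sum_{q=0}^p(-1)^q e_{i_0\dots\widehat{i_q}\dots i_p}$ (and $\partial=0$ on $\Lambda_0$). An elementary path is irregular if $i_k=i_{k+1}$ for some $k$; $\mathcal{I}_p$ is the span of irregular ones, $\mathcal{R}_p=\Lambda_p/\mathcal{I}_p$, and $\partial$ descends to $\mathcal{R}_p\to\mathcal{R}_{p-1}$ (so irregular paths are treated as $0$). An elementary path is allowed if $i_k\to i_{k+1}$ for all $k$; $\mathcal{A}_p(G)\subset\mathcal{R}_p$ is the span of allowed elementary $p$-paths, and $\Omega_p(G)=\{u\in\mathcal{A}_p(G):\partial u\in\mathcal{A}_{p-1}(G)\}$. For $m\ge2$ the trapezohedron $T_m$ is the digraph with $2m+2$ vertices $a,b,i_0,\dots,i_{m-1},j_0,\dots,j_{m-1}$ and $4m$ arrows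 $a\to i_k\to j_k\to b$, $i_{k+1}\to j_k$ ($k$ modulo $m$), and $\tau_m=\sum_{k=0}^{m-1}(e_{a i_k j_k b}-e_{a i_{k+1}j_k b})\in\Omega_3(T_m)$. A merging map $f:X\to Y$ of digraphs: the vertex set of $X$ is partitioned into nonempty sets $A_1,\dots,A_n$, $Y$ has vertices $a_1,\dots,a_n$, $f(x)=a_i$ for $x\in A_i$, and for $i\neq j$ one has $a_i\to a_j$ in $Y$ if and only if $x\to y$ in $X$ for some $x\in A_i$, $y\in A_j$. The induced linear map is $f_*(e_{i_0\dots i_p})=e_{f(i_0)\dots f(i_p)}$ (zero if irregular). A merging image of $\tau_m$ in $G$ is a path $f_*(\tau_m)$, where $f:T_m\to Y$ is a merging map onto a subgraph $Y$ of $G$; when $f$ is injective this is the trapezohedral path $\tau_m$ of a copy of $T_m$ in $G$. Time complexity is counted in elementary operations; a basis is output by listing the nonzero terms of each basis element. *)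

theory Defs
  imports
    "Graph_Theory.Pair_Digraph"
    "Graph_Theory.Digraph_Component"
    "HOL-Library.Poly_Mapping"
    "HOL-Library.Landau_Symbols"
begin

section \<open>The path complex\<close>

text \<open>
  Digraphs are \<^typ>\<open>'v pair_pre_digraph\<close>s satisfying \<^locale>\<open>pair_loopfree_digraph\<close> (possibly
  infinite) or \<^locale>\<open>pair_digraph\<close> (finite). The elementary \<open>p\<close>-path \<open>e\<close> with vertex sequence
  \<open>xs\<close>, \<open>length xs = p + 1\<close>, is \<open>el xs\<close>; all degrees live in the free vector space on
  \<^typ>\<open>'v list\<close>.
\<close>

definition scl :: "'k::field \<Rightarrow> ('a \<Rightarrow>\<^sub>0 'k) \<Rightarrow> ('a \<Rightarrow>\<^sub>0 'k)" where
  "scl c u = Poly_Mapping.map ((*) c) u"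

lemma lookup_scl [simp]: "Poly_Mapping.lookup (scl c u) x = c * Poly_Mapping.lookup u x"
  by (simp add: scl_def Poly_Mapping.map.rep_eq when_def)

global_interpretation pv: vector_space "scl :: 'k::field \<Rightarrow> ('a \<Rightarrow>\<^sub>0 'k) \<Rightarrow> ('a \<Rightarrow>\<^sub>0 'k)"
  by unfold_locales (auto intro!: poly_mapping_eqI simp: lookup_add algebra_simps)

definition el :: "'a \<Rightarrow> ('a \<Rightarrow>\<^sub>0 'k::field)" where
  "el xs = Poly_Mapping.single xs 1"

definition lin_ext :: "('a \<Rightarrow> ('b \<Rightarrow>\<^sub>0 'k)) \<Rightarrow> ('a \<Rightarrow>\<^sub>0 'k::field) \<Rightarrow> ('b \<Rightarrow>\<^sub>0 'k)" where
  "lin_ext g u = (\<Sum>xs\<in>Poly_Mapping.keys u. scl (Poly_Mapping.lookup u xs) (g xs))"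

definition face :: "nat \<Rightarrow> 'v list \<Rightarrow> 'v list" where
  "face q xs = take q xs @ drop (Suc q) xs"

definition bdry_el :: "'v list \<Rightarrow> ('v list \<Rightarrow>\<^sub>0 'k::field)" where
  "bdry_el xs = (if length xs \<le> 1 then 0
     else (\<Sum>q<length xs. scl ((-1) ^ q) (el (face q xs))))"

definition bdry :: "('v list \<Rightarrow>\<^sub>0 'k::field) \<Rightarrow> ('v list \<Rightarrow>\<^sub>0 'k)" where
  "bdry = lin_ext bdry_el"

definition irregular :: "'v list \<Rightarrow> bool" where
  "irregular xs \<longleftrightarrow> (\<exists>k. Suc k < length xs \<and> xs ! k = xs ! Suc k)"

text \<open>
  The quotient of the space of paths by the span of the irregular ones is represented by the
  complement spanned by the regular elementary paths, \<open>reg\<close> being the quotient map. The lemmas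
  \<open>reg_eq_0_iff\<close> and \<open>reg_bdry_reg\<close> below show that the kernel of \<open>reg\<close> is indeed the span of
  the irregular elementary paths and that \<open>rbdry\<close> is the induced boundary.
\<close>

definition reg_el :: "'v list \<Rightarrow> ('v list \<Rightarrow>\<^sub>0 'k::field)" where
  "reg_el xs = (if irregular xs then 0 else el xs)"

definition reg :: "('v list \<Rightarrow>\<^sub>0 'k::field) \<Rightarrow> ('v list \<Rightarrow>\<^sub>0 'k)" where
  "reg = lin_ext reg_el"

definition rbdry :: "('v list \<Rightarrow>\<^sub>0 'k::field) \<Rightarrow> ('v list \<Rightarrow>\<^sub>0 'k)" where
  "rbdry u = reg (bdry u)"

definition allowed_paths :: "nat \<Rightarrow> 'v pair_pre_digraph \<Rightarrow> 'v list set" where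
  "allowed_paths p G = {xs. length xs = Suc p \<and> set xs \<subseteq> pverts G \<and>
     (\<forall>k<p. (xs ! k, xs ! Suc k) \<in> parcs G)}"

definition Allowed :: "nat \<Rightarrow> 'v pair_pre_digraph \<Rightarrow> ('v list \<Rightarrow>\<^sub>0 'k::field) set" where
  "Allowed p G = pv.span (el ` allowed_paths p G)"

definition Omega :: "nat \<Rightarrow> 'v pair_pre_digraph \<Rightarrow> ('v list \<Rightarrow>\<^sub>0 'k::field) set" where
  "Omega p G = {u \<in> Allowed p G. rbdry u \<in> Allowed (p - 1) G}"

definition is_basis :: "('a \<Rightarrow>\<^sub>0 'k::field) set \<Rightarrow> ('a \<Rightarrow>\<^sub>0 'k) set \<Rightarrow> bool" where
  "is_basis B W \<longleftrightarrow> pv.independent B \<and> pv.span B = W"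

subsection \<open>The regular quotient\<close>

lemma lin_ext_superset:
  assumes "finite S" "Poly_Mapping.keys u \<subseteq> S"
  shows "lin_ext g u = (\<Sum>xs\<in>S. scl (Poly_Mapping.lookup u xs) (g xs))"
  unfolding lin_ext_def
  by (rule sum.mono_neutral_left[OF assms]) (auto simp: in_keys_iff)

lemma lin_ext_add: "lin_ext g (u + v) = lin_ext g u + lin_ext g v"
proof -
  let ?S = "Poly_Mapping.keys u \<union> Poly_Mapping.keys v"
  have "Poly_Mapping.keys (u + v) \<subseteq> ?S" by (rule keys_add)
  then show ?thesis
    by (simp add: lin_ext_superset[of ?S] lookup_add pv.scale_left_distrib sum.distrib)
qed

lemma lin_ext_scl: "lin_ext g (scl c u) = scl c (lin_ext g u)"
proof -
  have "Poly_Mapping.keys (scl c u) \<subseteq> Poly_Mapping.keys u" by (auto simp: in_keys_iff)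
  then show ?thesis
    by (simp add: lin_ext_superset[of "Poly_Mapping.keys u"] pv.scale_sum_right)
qed

lemma lin_ext_0 [simp]: "lin_ext g 0 = 0"
  by (simp add: lin_ext_def)

lemma lin_ext_sum: "lin_ext g (sum h S) = (\<Sum>x\<in>S. lin_ext g (h x))"
  by (induction S rule: infinite_finite_induct) (auto simp: lin_ext_add)

lemma lin_ext_el [simp]: "lin_ext g (el x) = g x"
  by (simp add: lin_ext_def el_def)

lemma sum_el: "(\<Sum>x\<in>Poly_Mapping.keys u. scl (Poly_Mapping.lookup u x) (el x)) = u"
proof (rule poly_mapping_eqI)
  fix y
  have "Poly_Mapping.lookup (\<Sum>x\<in>Poly_Mapping.keys u. scl (Poly_Mapping.lookup u x) (el x)) y
      = (\<Sum>x\<in>Poly_Mapping.keys u. if x = y then Poly_Mapping.lookup u y else 0)"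
    unfolding lookup_sum by (rule sum.cong) (auto simp: el_def lookup_single when_def)
  also have "\<dots> = Poly_Mapping.lookup u y"
    by (simp add: in_keys_iff)
  finally show "Poly_Mapping.lookup (\<Sum>x\<in>Poly_Mapping.keys u. scl (Poly_Mapping.lookup u x) (el x)) y = Poly_Mapping.lookup u y" .
qed

lemma lookup_reg: "Poly_Mapping.lookup (reg u) x = (if irregular x then 0 else Poly_Mapping.lookup u x)"
proof -
  have "Poly_Mapping.lookup (reg u) x
      = (\<Sum>y\<in>Poly_Mapping.keys u. if y = x then (if irregular x then 0 else Poly_Mapping.lookup u x) else 0)"
    unfolding reg_def lin_ext_def lookup_sum
    by (rule sum.cong) (auto simp: reg_el_def el_def lookup_single when_def)
  also have "\<dots> = (if irregular x then 0 else Poly_Mapping.lookup u x)"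
    by (simp add: in_keys_iff)
  finally show ?thesis .
qed

lemma reg_idem: "reg (reg u) = reg u"
  by (rule poly_mapping_eqI) (simp add: lookup_reg)

lemma reg_eq_0_iff:
  "reg u = 0 \<longleftrightarrow> u \<in> pv.span (el ` {xs. irregular xs})"
proof
  assume "reg u = 0"
  then have "irregular x" if "x \<in> Poly_Mapping.keys u" for x
    using that lookup_reg[of u x] by (auto simp: in_keys_iff split: if_splits)
  then have "(\<Sum>x\<in>Poly_Mapping.keys u. scl (Poly_Mapping.lookup u x) (el x)) \<in> pv.span (el ` {xs. irregular xs})"
    by (intro pv.span_sum pv.span_scale pv.span_base) auto
  then show "u \<in> pv.span (el ` {xs. irregular xs})"
    by (simp add: sum_el)
next
  assume "u \<in> pv.span (el ` {xs. irregular xs})"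
  then show "reg u = 0"
    by (induction rule: pv.span_induct_alt)
      (auto simp: reg_def lin_ext_add lin_ext_scl reg_el_def)
qed

lemma reg_bdry_el_irregular:
  assumes "irregular xs"
  shows "reg (bdry_el xs) = 0"
proof -
  obtain k where k: "Suc k < length xs" "xs ! k = xs ! Suc k"
    using assms by (auto simp: irregular_def)
  let ?f = "\<lambda>q. scl ((-1) ^ q) (reg_el (face q xs))"
  have face_nth: "face q xs ! i = (if i < q then xs ! i else xs ! Suc i)"
    if "q < length xs" "i < length xs - 1" for q i
    using that by (auto simp: face_def nth_append)
  have len: "length (face q xs) = length xs - 1" if "q < length xs" for q
    using that by (auto simp: face_def)
  have irr: "reg_el (face q xs) = 0" if "q < length xs" "q \<noteq> k" "q \<noteq> Suc k" for q
  proof -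
    define j where "j = (if q < k then k - 1 else k)"
    have "Suc j < length (face q xs) \<and> face q xs ! j = face q xs ! Suc j"
      using that k by (auto simp: j_def len face_nth)
    then show ?thesis by (auto simp: reg_el_def irregular_def)
  qed
  have "face k xs = face (Suc k) xs"
    by (rule nth_equalityI) (use k in \<open>auto simp: len face_nth less_Suc_eq\<close>)
  then have two: "?f k + ?f (Suc k) = 0"
    by simp
  have "reg (bdry_el xs) = (\<Sum>q<length xs. ?f q)"
    using k by (simp add: bdry_el_def reg_def lin_ext_sum lin_ext_scl)
  also have "\<dots> = (\<Sum>q\<in>{k, Suc k}. ?f q)"
    by (rule sum.mono_neutral_right) (use k irr in auto)
  also have "\<dots> = 0"
    using two by simp
  finally show ?thesis .
qed

lemma reg_bdry_reg:
  fixes u :: "'v list \<Rightarrow>\<^sub>0 'k::field"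
  shows "reg (bdry (reg u)) = reg (bdry u)"
proof -
  have "reg (bdry (reg_el x)) = reg (bdry (el x :: 'v list \<Rightarrow>\<^sub>0 'k))" for x
    using reg_bdry_el_irregular[of x]
    by (auto simp: reg_el_def bdry_def) (simp add: reg_def)
  moreover have "reg (bdry (\<Sum>x\<in>Poly_Mapping.keys u. scl (Poly_Mapping.lookup u x) (h x)))
      = (\<Sum>x\<in>Poly_Mapping.keys u. scl (Poly_Mapping.lookup u x) (reg (bdry (h x))))" for h :: "'v list \<Rightarrow> ('v list \<Rightarrow>\<^sub>0 'k)"
    by (simp add: reg_def bdry_def lin_ext_sum lin_ext_scl)
  ultimately have "reg (bdry (\<Sum>x\<in>Poly_Mapping.keys u. scl (Poly_Mapping.lookup u x) (reg_el x)))
      = reg (bdry (\<Sum>x\<in>Poly_Mapping.keys u. scl (Poly_Mapping.lookup u x) (el x)))"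
    by simp
  then show ?thesis
    unfolding sum_el lin_ext_def[symmetric] reg_def[symmetric] .
qed

section \<open>Trapezohedra and merging images\<close>

datatype trap_vertex = TA | TB | TI nat | TJ nat

definition trapezohedron :: "nat \<Rightarrow> trap_vertex pair_pre_digraph" where
  "trapezohedron m =
     \<lparr> pverts = {TA, TB} \<union> TI ` {..<m} \<union> TJ ` {..<m},
       parcs = (\<Union>k<m. {(TA, TI k), (TI k, TJ k), (TJ k, TB), (TI (Suc k mod m), TJ k)}) \<rparr>"

definition trap_path :: "nat \<Rightarrow> (trap_vertex list \<Rightarrow>\<^sub>0 'k::field)" where
  "trap_path m =
     (\<Sum>k<m. el [TA, TI k, TJ k, TB] - el [TA, TI (Suc k mod m), TJ k, TB])"

text \<open>
  The partition underlying a merging map consists of the fibres of \<open>f\<close>. The partition sets being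
  nonempty and indexed by the vertices of \<open>Y\<close> means that \<open>f\<close> is onto.
\<close>

definition merging_map ::
  "'v pair_pre_digraph \<Rightarrow> 'w pair_pre_digraph \<Rightarrow> ('v \<Rightarrow> 'w) \<Rightarrow> bool" where
  "merging_map X Y f \<longleftrightarrow> f ` pverts X = pverts Y \<and>
     (\<forall>p\<in>pverts Y. \<forall>q\<in>pverts Y. p \<noteq> q \<longrightarrow>
        ((p, q) \<in> parcs Y \<longleftrightarrow>
          (\<exists>x\<in>pverts X. \<exists>y\<in>pverts X. f x = p \<and> f y = q \<and> (x, y) \<in> parcs X)))"

definition push :: "('v \<Rightarrow> 'w) \<Rightarrow> ('v list \<Rightarrow>\<^sub>0 'k::field) \<Rightarrow> ('w list \<Rightarrow>\<^sub>0 'k)" where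
  "push f = lin_ext (\<lambda>xs. reg_el (map f xs))"

text \<open>For injective \<open>f\<close> these are the trapezohedral paths of the copies of \<open>T\<^sub>m\<close> in \<open>G\<close>.\<close>

definition merging_images :: "'v pair_pre_digraph \<Rightarrow> ('v list \<Rightarrow>\<^sub>0 'k::field) set" where
  "merging_images G = {push f (trap_path m) | m Y f.
     m \<ge> 2 \<and> pair_loopfree_digraph Y \<and> subgraph (with_proj Y) (with_proj G) \<and>
     merging_map (trapezohedron m) Y f}"

section \<open>Random access machines over a field\<close>

text \<open>
  Programs operate on arrays of natural numbers and on arrays of field elements. A cell is
  addressed by the name of the array and a tuple of indices, whose length is fixed by the program
  text. Expressions over natural numbers are built with successor and predecessor only: no number
  ever exceeds the maximum of the input and the literals of the program by more than the running
  time. So numbers and addresses have \<open>O(log (size + time))\<close> bits, and charging unit cost for each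
  operation does not hide work on large numbers. Arithmetic in the field and testing field elements for equality are
  elementary operations too.
\<close>

datatype nexp =
    NLit nat
  | NGet string "nexp list"
  | NSucc nexp
  | NPred nexp

datatype kexp =
    KZero
  | KOne
  | KGet string "nexp list"
  | KAdd kexp kexp
  | KSub kexp kexp
  | KMul kexp kexp
  | KDiv kexp kexp

datatype bexp =
    NLess nexp nexp
  | NEq nexp nexp
  | KEq kexp kexp
  | BNot bexp
  | BAnd bexp bexp

datatype com =
    Skip
  | NSet string "nexp list" nexp
  | KSet string "nexp list" kexp
  | Seq com com
  | Cond bexp com com
  | While bexp com

record 'k store =
  ncell :: "string \<Rightarrow> nat list \<Rightarrow> nat"
  kcell :: "string \<Rightarrow> nat list \<Rightarrow> 'k"

fun nval :: "'k store \<Rightarrow> nexp \<Rightarrow> nat" where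
  "nval s (NLit c) = c"
| "nval s (NGet a is) = ncell s a (map (nval s) is)"
| "nval s (NSucc x) = Suc (nval s x)"
| "nval s (NPred x) = nval s x - 1"

fun kval :: "('k::field) store \<Rightarrow> kexp \<Rightarrow> 'k" where
  "kval s KZero = 0"
| "kval s KOne = 1"
| "kval s (KGet a is) = kcell s a (map (nval s) is)"
| "kval s (KAdd x y) = kval s x + kval s y"
| "kval s (KSub x y) = kval s x - kval s y"
| "kval s (KMul x y) = kval s x * kval s y"
| "kval s (KDiv x y) = kval s x / kval s y"

fun bval :: "('k::field) store \<Rightarrow> bexp \<Rightarrow> bool" where
  "bval s (NLess x y) = (nval s x < nval s y)"
| "bval s (NEq x y) = (nval s x = nval s y)"
| "bval s (KEq x y) = (kval s x = kval s y)"
| "bval s (BNot b) = (\<not> bval s b)"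
| "bval s (BAnd b c) = (bval s b \<and> bval s c)"

text \<open>The cost of an expression is its number of nodes.\<close>

fun ncost :: "nexp \<Rightarrow> nat" where
  "ncost (NLit c) = 1"
| "ncost (NGet a is) = Suc (sum_list (map ncost is))"
| "ncost (NSucc x) = Suc (ncost x)"
| "ncost (NPred x) = Suc (ncost x)"

fun kcost :: "kexp \<Rightarrow> nat" where
  "kcost KZero = 1"
| "kcost KOne = 1"
| "kcost (KGet a is) = Suc (sum_list (map ncost is))"
| "kcost (KAdd x y) = Suc (kcost x + kcost y)"
| "kcost (KSub x y) = Suc (kcost x + kcost y)"
| "kcost (KMul x y) = Suc (kcost x + kcost y)"
| "kcost (KDiv x y) = Suc (kcost x + kcost y)"

fun bcost :: "bexp \<Rightarrow> nat" where
  "bcost (NLess x y) = Suc (ncost x + ncost y)"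
| "bcost (NEq x y) = Suc (ncost x + ncost y)"
| "bcost (KEq x y) = Suc (kcost x + kcost y)"
| "bcost (BNot b) = Suc (bcost b)"
| "bcost (BAnd b c) = Suc (bcost b + bcost c)"

definition nset :: "string \<Rightarrow> nat list \<Rightarrow> nat \<Rightarrow> 'k store \<Rightarrow> 'k store" where
  "nset a js c s = s\<lparr>ncell := (ncell s)(a := (ncell s a)(js := c))\<rparr>"

definition kset :: "string \<Rightarrow> nat list \<Rightarrow> 'k \<Rightarrow> 'k store \<Rightarrow> 'k store" where
  "kset a js c s = s\<lparr>kcell := (kcell s)(a := (kcell s a)(js := c))\<rparr>"

text \<open>\<open>exec c s t s'\<close>: started in \<open>s\<close>, program \<open>c\<close> halts in \<open>s'\<close> after \<open>t\<close> elementary operations.\<close>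

inductive exec :: "com \<Rightarrow> ('k::field) store \<Rightarrow> nat \<Rightarrow> 'k store \<Rightarrow> bool" where
  Skip: "exec Skip s 1 s"
| NSet: "exec (NSet a is x) s (Suc (sum_list (map ncost is) + ncost x))
     (nset a (map (nval s) is) (nval s x) s)"
| KSet: "exec (KSet a is x) s (Suc (sum_list (map ncost is) + kcost x))
     (kset a (map (nval s) is) (kval s x) s)"
| Seq: "exec c1 s t1 s1 \<Longrightarrow> exec c2 s1 t2 s2 \<Longrightarrow> exec (Seq c1 c2) s (t1 + t2) s2"
| CondTrue: "bval s b \<Longrightarrow> exec c1 s t s' \<Longrightarrow> exec (Cond b c1 c2) s (Suc (bcost b + t)) s'"
| CondFalse: "\<not> bval s b \<Longrightarrow> exec c2 s t s' \<Longrightarrow> exec (Cond b c1 c2) s (Suc (bcost b + t)) s'"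
| WhileFalse: "\<not> bval s b \<Longrightarrow> exec (While b c) s (Suc (bcost b)) s"
| WhileTrue: "bval s b \<Longrightarrow> exec c s t1 s1 \<Longrightarrow> exec (While b c) s1 t2 s2 \<Longrightarrow>
     exec (While b c) s (Suc (bcost b + t1 + t2)) s2"

inductive_cases SkipE: "exec Skip s t s'"
inductive_cases NSetE: "exec (NSet a is x) s t s'"
inductive_cases KSetE: "exec (KSet a is x) s t s'"
inductive_cases SeqE: "exec (Seq c1 c2) s t s'"
inductive_cases CondE: "exec (Cond b c1 c2) s t s'"
inductive_cases WhileE: "exec (While b c) s t s'"

lemma exec_deterministic:
  "exec c s t s' \<Longrightarrow> exec c s u s'' \<Longrightarrow> u = t \<and> s'' = s'"
proof (induction arbitrary: u s'' rule: exec.induct)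
  case (Skip s)
  then show ?case by (auto elim: SkipE)
next
  case (NSet a js x s)
  then show ?case by (auto elim: NSetE)
next
  case (KSet a js x s)
  then show ?case by (auto elim: KSetE)
next
  case (Seq c1 s t1 s1 c2 t2 s2)
  from Seq.prems obtain u1 r u2 where "exec c1 s u1 r" "exec c2 r u2 s''" "u = u1 + u2"
    by (rule SeqE)
  then show ?case using Seq.IH by blast
next
  case (CondTrue s b c1 t s' c2)
  from CondTrue.prems CondTrue.hyps obtain u1 where "exec c1 s u1 s''" "u = Suc (bcost b + u1)"
    by (cases rule: CondE) auto
  then show ?case using CondTrue.IH by blast
next
  case (CondFalse s b c2 t s' c1)
  from CondFalse.prems CondFalse.hyps obtain u1 where "exec c2 s u1 s''" "u = Suc (bcost b + u1)"
    by (cases rule: CondE) auto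
  then show ?case using CondFalse.IH by blast
next
  case (WhileFalse s b c)
  from WhileFalse.prems WhileFalse.hyps show ?case
    by (cases rule: WhileE) auto
next
  case (WhileTrue s b c t1 s1 t2 s2)
  from WhileTrue.prems WhileTrue.hyps(1) obtain u1 r u2 where
    "exec c s u1 r" "exec (While b c) r u2 s''" "u = Suc (bcost b + u1 + u2)"
    by (cases rule: WhileE) auto
  then show ?case using WhileTrue.IH by blast
qed

subsection \<open>Input and output\<close>

text \<open>
  A digraph with vertex set \<open>{0, ..., n - 1}\<close> is input as its number of vertices and its adjacency
  matrix. All other cells are initially zero.
\<close>

definition input_store :: "nat \<Rightarrow> nat pair_pre_digraph \<Rightarrow> 'k::field store" where
  "input_store n G =
     \<lparr> ncell = (\<lambda>a is.
         if a = ''n'' \<and> is = [] then n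
         else if \<exists>u v. a = ''adj'' \<and> is = [u, v] \<and> (u, v) \<in> parcs G then 1
         else 0),
       kcell = (\<lambda>a is. 0) \<rparr>"

text \<open>
  The output is read off as follows: \<open>dim[]\<close> is the dimension and the number of basis elements;
  basis element \<open>t\<close> is a sum of \<open>len[t]\<close> terms, the \<open>r\<close>-th one having coefficient \<open>coef[t,r]\<close>
  and vertices \<open>vert[t,r,0], ..., vert[t,r,3]\<close>.
\<close>

definition out_dim :: "'k store \<Rightarrow> nat" where
  "out_dim s = ncell s ''dim'' []"

definition out_len :: "'k store \<Rightarrow> nat \<Rightarrow> nat" where
  "out_len s t = ncell s ''len'' [t]"

definition out_coef :: "'k store \<Rightarrow> nat \<Rightarrow> nat \<Rightarrow> 'k" where
  "out_coef s t r = kcell s ''coef'' [t, r]"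

definition out_path :: "'k store \<Rightarrow> nat \<Rightarrow> nat \<Rightarrow> nat list" where
  "out_path s t r = map (\<lambda>q. ncell s ''vert'' [t, r, q]) [0..<4]"

definition out_elem :: "'k store \<Rightarrow> nat \<Rightarrow> (nat list \<Rightarrow>\<^sub>0 'k::field)" where
  "out_elem s t = (\<Sum>r<out_len s t. scl (out_coef s t r) (el (out_path s t r)))"

text \<open>
  Each term listed is nonzero and no elementary path is listed twice within a basis element.
\<close>

definition outputs_basis :: "'k store \<Rightarrow> (nat list \<Rightarrow>\<^sub>0 'k::field) set \<Rightarrow> bool" where
  "outputs_basis s W \<longleftrightarrow>
     out_dim s = pv.dim W \<and>
     inj_on (out_elem s) {..<out_dim s} \<and>
     is_basis (out_elem s ` {..<out_dim s}) W \<and>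
     (\<forall>t<out_dim s. inj_on (out_path s t) {..<out_len s t} \<and>
        (\<forall>r<out_len s t. out_coef s t r \<noteq> 0))"

end

theory Submission
  imports Defs
begin

text \<open>
  The conditions defining \<open>\<Omega>\<^sub>3\<close> decouple. For fixed end vertices \<open>a\<close> and \<open>d\<close> they say that
  the coefficients of the paths \<open>a b c d\<close> form a flow in the bipartite graph with the edges
  \<open>b \<rightarrow> c\<close>, conserved at all \<open>b\<close> except those with \<open>b = d\<close> or \<open>b \<rightarrow> d\<close>, and at all \<open>c\<close> except
  those with \<open>a = c\<close> or \<open>a \<rightarrow> c\<close>. Flows are spanned by closed walks and by walks joining two
  exceptional vertices. Exceptional vertices are joined through \<open>a\<close> and \<open>d\<close> by irregular paths,
  which count as zero, so that walks of both kinds are closed walks in a larger bipartite graph; and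
  a closed walk of length \<open>2 m\<close> there is a map from \<open>T\<^sub>m\<close> to the digraph.

  A basis of the flows consists of the fundamental cycles of a spanning forest in which the
  exceptional vertices count as one vertex. The forest is built by merging components, each vertex
  carrying its path to the root as a vector. There are at most \<open>2 n\<close> merges of cost \<open>O(n\<^sup>2)\<close> and
  at most \<open>n\<^sup>2\<close> fundamental cycles of cost \<open>O(n)\<close>, so that each of the \<open>n\<^sup>2\<close> pairs \<open>(a, d)\<close>
  costs \<open>O(n\<^sup>3)\<close>.
\<close>

section \<open>The conditions defining \<open>\<Omega>\<^sub>3\<close>\<close>

text \<open>No flow is decomposed into cycles step by step. Take vectors \<open>P\<close>,
  \<open>Q\<close> that vanish wherever a condition is void. The conditions on \<open>u\<close> then
  make the corrections by \<open>P\<close> and \<open>Q\<close> sum to 0, so \<open>u\<close> is a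
  combination of corrected edges with its own coefficients. It remains to choose \<open>P\<close>
  and \<open>Q\<close> such that every corrected edge is a closed walk, for the first half, or lies
  in the span of the output, for the second. Since \<open>u\<close> has finite support, this covers
  infinite digraphs. The two halves share this reduction but not the basis. For the first, walks are
  chosen arbitrarily, and the merging images they yield are thinned to a basis. The cycles of the
  algorithm are independent by construction, because each contains an edge that no other one
  contains. A single edge may trigger a merge of cost \<open>O(n^2)\<close>, too much if charged to
  each of the \<open>n^2\<close> edges of a pair; the time bound therefore charges merges to the
  growth of the tree.\<close>

abbreviation "lkp \<equiv> Poly_Mapping.lookup"

section \<open>Linear algebra on elementary paths\<close>

lemma lookup_el: "lkp (el x) y = (if x = y then 1 else 0)"
  by (simp add: el_def lookup_single when_def)

lemma keys_el [simp]: "Poly_Mapping.keys (el x :: 'a \<Rightarrow>\<^sub>0 'k::field) = {x}"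
  by (simp add: el_def)

lemma span_el: "pv.span (el ` S) = {u :: 'a \<Rightarrow>\<^sub>0 'k::field. Poly_Mapping.keys u \<subseteq> S}"
proof (intro equalityI subsetI CollectI)
  fix u :: "'a \<Rightarrow>\<^sub>0 'k" and x assume "u \<in> pv.span (el ` S)" "x \<in> Poly_Mapping.keys u"
  moreover from this(1) have "\<forall>x. x \<notin> S \<longrightarrow> lkp u x = 0"
    by (induction rule: pv.span_induct_alt) (auto simp: lookup_add lookup_el split: if_splits)
  ultimately show "x \<in> S" by (auto simp: in_keys_iff)
next
  fix u :: "'a \<Rightarrow>\<^sub>0 'k" assume "u \<in> {u. Poly_Mapping.keys u \<subseteq> S}"
  then have "(\<Sum>x\<in>Poly_Mapping.keys u. scl (lkp u x) (el x)) \<in> pv.span (el ` S)"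
    by (intro pv.span_sum pv.span_scale pv.span_base) auto
  then show "u \<in> pv.span (el ` S)" by (simp add: sum_el)
qed

lemma Allowed_iff: "u \<in> Allowed p G \<longleftrightarrow> Poly_Mapping.keys u \<subseteq> allowed_paths p G"
  by (simp add: Allowed_def span_el)

text \<open>Summing over the keys keeps the sum finite for infinite \<open>S\<close>, such as
  \<open>via1\<close> and \<open>via2\<close> below.\<close>

definition mass :: "'a set \<Rightarrow> ('a \<Rightarrow>\<^sub>0 'k::field) \<Rightarrow> 'k" where
  "mass S u = (\<Sum>x\<in>Poly_Mapping.keys u. if x \<in> S then lkp u x else 0)"

lemma mass_superset:
  assumes "finite K" "Poly_Mapping.keys u \<subseteq> K"
  shows "mass S u = (\<Sum>x\<in>K. if x \<in> S then lkp u x else 0)"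
  unfolding mass_def
  by (rule sum.mono_neutral_left[OF assms]) (auto simp: in_keys_iff)

lemma mass_add [simp]: "mass S (u + v) = mass S u + mass S v"
proof -
  let ?K = "Poly_Mapping.keys u \<union> Poly_Mapping.keys v"
  have "Poly_Mapping.keys (u + v) \<subseteq> ?K" by (rule keys_add)
  then show ?thesis
    by (simp add: mass_superset[of ?K] lookup_add sum.distrib[symmetric] cong: if_cong)
      (rule sum.cong, auto)
qed

lemma mass_scl [simp]: "mass S (scl c u) = c * mass S u"
proof -
  have "Poly_Mapping.keys (scl c u) \<subseteq> Poly_Mapping.keys u" by (auto simp: in_keys_iff)
  then have "mass S (scl c u) = (\<Sum>x\<in>Poly_Mapping.keys u. if x \<in> S then lkp (scl c u) x else 0)"
    by (simp add: mass_superset[of "Poly_Mapping.keys u"])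
  also have "\<dots> = c * mass S u"
    unfolding mass_def sum_distrib_left by (rule sum.cong) auto
  finally show ?thesis .
qed

lemma mass_0 [simp]: "mass S 0 = 0"
  by (simp add: mass_def)

lemma mass_uminus [simp]: "mass S (- u) = - mass S u"
  using mass_scl[of S "-1" u] by simp

lemma mass_diff [simp]: "mass S (u - v) = mass S u - mass S v"
  using mass_add[of S u "- v"] by simp

lemma mass_el [simp]: "mass S (el x) = (if x \<in> S then 1 else 0)"
  by (simp add: mass_def lookup_el)

lemma mass_eq_0: "Poly_Mapping.keys u \<inter> S = {} \<Longrightarrow> mass S u = 0"
  unfolding mass_def by (rule sum.neutral) auto

text \<open>These are the fibres of the two inner face maps: deleting the third vertex takes
  \<open>via1 a b d\<close> to \<open>[a, b, d]\<close>, deleting the second takes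
  \<open>via2 a c d\<close> to \<open>[a, c, d]\<close>.\<close>

definition via1 :: "'v \<Rightarrow> 'v \<Rightarrow> 'v \<Rightarrow> 'v list set" where
  "via1 a b d = {[a, b, c, d] | c. True}"

definition via2 :: "'v \<Rightarrow> 'v \<Rightarrow> 'v \<Rightarrow> 'v list set" where
  "via2 a c d = {[a, b, c, d] | b. True}"

lemma via_iff [simp]:
  "[x, y, z, w] \<in> via1 a b d \<longleftrightarrow> x = a \<and> y = b \<and> w = d"
  "[x, y, z, w] \<in> via2 a c d \<longleftrightarrow> x = a \<and> z = c \<and> w = d"
  by (auto simp: via1_def via2_def)

section \<open>Allowed and irregular paths in low degree\<close>

lemma allowed3_iff:
  assumes "pair_loopfree_digraph G"
  shows "xs \<in> allowed_paths 3 G \<longleftrightarrow>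
    (\<exists>a b c d. xs = [a, b, c, d] \<and> (a, b) \<in> parcs G \<and> (b, c) \<in> parcs G \<and> (c, d) \<in> parcs G)"
proof -
  interpret pair_loopfree_digraph G by fact
  have 3: "3 = Suc (Suc (Suc 0))" by simp
  show ?thesis
  proof
    assume "xs \<in> allowed_paths 3 G"
    then have "length xs = 4" "\<forall>k<3. (xs ! k, xs ! Suc k) \<in> parcs G"
      by (auto simp: allowed_paths_def)
    then show "\<exists>a b c d. xs = [a, b, c, d] \<and> (a, b) \<in> parcs G \<and> (b, c) \<in> parcs G \<and> (c, d) \<in> parcs G"
      by (auto simp: eval_nat_numeral length_Suc_conv All_less_Suc)
  next
    assume "\<exists>a b c d. xs = [a, b, c, d] \<and> (a, b) \<in> parcs G \<and> (b, c) \<in> parcs G \<and> (c, d) \<in> parcs G"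
    then show "xs \<in> allowed_paths 3 G"
      using in_arcsD1 in_arcsD2
      by (auto simp: allowed_paths_def 3 All_less_Suc dest: in_arcsD1 in_arcsD2)
  qed
qed

lemma allowed2_iff:
  assumes "pair_loopfree_digraph G"
  shows "[x, y, z] \<in> allowed_paths 2 G \<longleftrightarrow> (x, y) \<in> parcs G \<and> (y, z) \<in> parcs G"
proof -
  interpret pair_loopfree_digraph G by fact
  show ?thesis
    by (auto simp: allowed_paths_def eval_nat_numeral All_less_Suc dest: in_arcsD1 in_arcsD2)
qed

lemma irregular_Cons_Cons: "irregular (x # y # zs) \<longleftrightarrow> x = y \<or> irregular (y # zs)"
proof
  assume "irregular (x # y # zs)"
  then obtain k where k: "Suc k < length (x # y # zs)" "(x # y # zs) ! k = (x # y # zs) ! Suc k"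
    unfolding irregular_def by blast
  then show "x = y \<or> irregular (y # zs)" by (cases k) (auto simp: irregular_def)
next
  assume "x = y \<or> irregular (y # zs)"
  then show "irregular (x # y # zs)"
    unfolding irregular_def by (elim disjE exE) (rule exI[of _ 0], simp, rule exI[of _ "Suc k" for k], simp)
qed

lemma irregular_single: "\<not> irregular [x]"
  by (simp add: irregular_def)

lemma irregular_3: "irregular [x, y, z] \<longleftrightarrow> x = y \<or> y = z"
  by (simp add: irregular_Cons_Cons irregular_single)

lemma irregular_4: "irregular [x, y, z, w] \<longleftrightarrow> x = y \<or> y = z \<or> z = w"
  by (simp add: irregular_Cons_Cons irregular_single)

lemma bdry_el_3:
  "bdry_el [a, b, c, d] = el [b, c, d] - el [a, c, d] + el [a, b, d] - (el [a, b, c] :: 'v list \<Rightarrow>\<^sub>0 'k::field)"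
  by (simp add: bdry_el_def face_def lessThan_Suc eval_nat_numeral algebra_simps)

text \<open>Deleting an end of an allowed path leaves an allowed path. So a non-allowed
  \<open>ys\<close> receives contributions from the two inner faces only, with opposite
  signs.\<close>

lemma lookup_bdry:
  fixes u :: "'v list \<Rightarrow>\<^sub>0 'k::field"
  assumes G: "pair_loopfree_digraph G" and u: "Poly_Mapping.keys u \<subseteq> allowed_paths 3 G"
    and y: "ys \<notin> allowed_paths 2 G"
  shows "lkp (bdry u) ys = (case ys of [x, y, z] \<Rightarrow> mass (via1 x y z) u - mass (via2 x y z) u | _ \<Rightarrow> 0)"
proof -
  have "lkp (bdry u) ys = (\<Sum>xs\<in>Poly_Mapping.keys u. lkp u xs * lkp (bdry_el xs) ys)"
    by (simp add: bdry_def lin_ext_def lookup_sum)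
  also have "\<dots> = (\<Sum>xs\<in>Poly_Mapping.keys u. case ys of [x, y, z] \<Rightarrow>
      (if xs \<in> via1 x y z then lkp u xs else 0) - (if xs \<in> via2 x y z then lkp u xs else 0) | _ \<Rightarrow> 0)"
  proof (rule sum.cong[OF refl])
    fix xs assume "xs \<in> Poly_Mapping.keys u"
    then obtain a b c d where xs: "xs = [a, b, c, d]" "(a, b) \<in> parcs G" "(b, c) \<in> parcs G" "(c, d) \<in> parcs G"
      using u allowed3_iff[OF G] by blast
    then have "[a, b, c] \<noteq> ys" "[b, c, d] \<noteq> ys"
      using y allowed2_iff[OF G] by auto
    then show "lkp u xs * lkp (bdry_el xs) ys = (case ys of [x, y, z] \<Rightarrow>
      (if xs \<in> via1 x y z then lkp u xs else 0) - (if xs \<in> via2 x y z then lkp u xs else 0) | _ \<Rightarrow> 0)"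
      by (auto simp: xs(1) bdry_el_3 lookup_add lookup_minus lookup_el split: list.splits)
  qed
  also have "\<dots> = (case ys of [x, y, z] \<Rightarrow> mass (via1 x y z) u - mass (via2 x y z) u | _ \<Rightarrow> 0)"
    by (auto simp: mass_def sum_subtractf split: list.splits)
  finally show ?thesis .
qed

text \<open>The conditions on the two inner vertices decouple: a non-allowed face \<open>[x, y, z]\<close> arises by
  deleting the vertex before \<open>y\<close> only if \<open>y \<rightarrow> z\<close>, and the vertex after \<open>y\<close> only if \<open>x \<rightarrow> y\<close>.\<close>

lemma Omega3_iff:
  fixes u :: "'v list \<Rightarrow>\<^sub>0 'k::field"
  assumes G: "pair_loopfree_digraph G"
  shows "u \<in> Omega 3 G \<longleftrightarrow> Poly_Mapping.keys u \<subseteq> allowed_paths 3 G \<and>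
    (\<forall>a b d. b \<noteq> d \<longrightarrow> (b, d) \<notin> parcs G \<longrightarrow> mass (via1 a b d) u = 0) \<and>
    (\<forall>a c d. a \<noteq> c \<longrightarrow> (a, c) \<notin> parcs G \<longrightarrow> mass (via2 a c d) u = 0)"
proof (cases "Poly_Mapping.keys u \<subseteq> allowed_paths 3 G")
  case True
  interpret pair_loopfree_digraph G by fact
  have nl: "(x, x) \<notin> parcs G" for x using no_loops by force
  have m1: "mass (via1 x y z) u = 0" if "(x, y) \<notin> parcs G" for x y z
    using True that by (intro mass_eq_0) (auto simp: allowed3_iff[OF G] subset_iff via1_def)
  have m2: "mass (via2 x y z) u = 0" if "(y, z) \<notin> parcs G" for x y z
    using True that by (intro mass_eq_0) (auto simp: allowed3_iff[OF G] subset_iff via2_def)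
  have "rbdry u \<in> Allowed 2 G \<longleftrightarrow> (\<forall>ys. ys \<notin> allowed_paths 2 G \<longrightarrow> \<not> irregular ys \<longrightarrow> lkp (bdry u) ys = 0)"
    unfolding Allowed_iff rbdry_def subset_iff in_keys_iff lookup_reg by auto
  also have "\<dots> \<longleftrightarrow> (\<forall>x y z. \<not> ((x, y) \<in> parcs G \<and> (y, z) \<in> parcs G) \<longrightarrow> x \<noteq> y \<longrightarrow> y \<noteq> z
      \<longrightarrow> mass (via1 x y z) u = mass (via2 x y z) u)" (is "?L \<longleftrightarrow> ?R")
  proof
    assume ?L
    show ?R
    proof (intro allI impI)
      fix x y z assume "\<not> ((x, y) \<in> parcs G \<and> (y, z) \<in> parcs G)" "x \<noteq> y" "y \<noteq> z"
      then have "lkp (bdry u) [x, y, z] = 0" "[x, y, z] \<notin> allowed_paths 2 G"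
        using \<open>?L\<close> allowed2_iff[OF G] irregular_3 by metis+
      then show "mass (via1 x y z) u = mass (via2 x y z) u"
        using lookup_bdry[OF G True, of "[x, y, z]"] by simp
    qed
  next
    assume ?R
    show ?L
    proof (intro allI impI)
      fix ys :: "'v list" assume ys: "ys \<notin> allowed_paths 2 G" "\<not> irregular ys"
      show "lkp (bdry u) ys = 0"
      proof (cases "\<exists>x y z. ys = [x, y, z]")
        case True
        then obtain x y z where "ys = [x, y, z]" by blast
        then show ?thesis
          using \<open>?R\<close> ys lookup_bdry[OF G \<open>Poly_Mapping.keys u \<subseteq> allowed_paths 3 G\<close> ys(1)]
          by (simp add: irregular_3 allowed2_iff[OF G])
      next
        case False
        then show ?thesis
          unfolding lookup_bdry[OF G \<open>Poly_Mapping.keys u \<subseteq> allowed_paths 3 G\<close> ys(1)]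
          by (metis (no_types, lifting) list.case_eq_if list.exhaust_sel)
      qed
    qed
  qed
  also have "\<dots> \<longleftrightarrow> (\<forall>a b d. b \<noteq> d \<longrightarrow> (b, d) \<notin> parcs G \<longrightarrow> mass (via1 a b d) u = 0) \<and>
    (\<forall>a c d. a \<noteq> c \<longrightarrow> (a, c) \<notin> parcs G \<longrightarrow> mass (via2 a c d) u = 0)" (is "?R \<longleftrightarrow> ?C1 \<and> ?C2")
  proof
    assume R: ?R
    \<comment> \<open>For \<open>a = b\<close> the face is irregular and \<open>R\<close> says
      nothing; the mass is then 0 because there are no loops.\<close>
    have "mass (via1 a b d) u = 0" if "b \<noteq> d" "(b, d) \<notin> parcs G" for a b d
      using R[rule_format, of a b d] m1[of a b d] m2[of b d a] nl[of a] that by (cases "a = b") auto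
    moreover have "mass (via2 a c d) u = 0" if "a \<noteq> c" "(a, c) \<notin> parcs G" for a c d
      using R[rule_format, of a c d] m1[of a c d] m2[of c d a] nl[of d] that by (cases "c = d") auto
    ultimately show "?C1 \<and> ?C2" by blast
  next
    assume C: "?C1 \<and> ?C2"
    show ?R
    proof (intro allI impI)
      fix x y z assume "\<not> ((x, y) \<in> parcs G \<and> (y, z) \<in> parcs G)" "x \<noteq> y" "y \<noteq> z"
      then show "mass (via1 x y z) u = mass (via2 x y z) u"
        using C m1[of x y z] m2[of y z x] by (cases "(x, y) \<in> parcs G") auto
    qed
  qed
  finally show ?thesis using True by (simp add: Omega_def Allowed_iff)
qed (simp add: Omega_def Allowed_iff)

lemma subspace_Omega3:
  assumes "pair_loopfree_digraph G"
  shows "pv.subspace (Omega 3 G)"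
proof -
  have "Omega 3 G = {u. \<forall>x. x \<notin> allowed_paths 3 G \<longrightarrow> lkp u x = 0} \<inter>
    {u. (\<forall>a b d. b \<noteq> d \<longrightarrow> (b, d) \<notin> parcs G \<longrightarrow> mass (via1 a b d) u = 0) \<and>
    (\<forall>a c d. a \<noteq> c \<longrightarrow> (a, c) \<notin> parcs G \<longrightarrow> mass (via2 a c d) u = 0)}"
    unfolding Omega3_iff[OF assms] set_eq_iff subset_iff in_keys_iff by auto
  then show ?thesis by (auto simp: pv.subspace_def lookup_add)
qed

section \<open>Closed walks and merging images\<close>

text \<open>
  For fixed end vertices \<open>a\<close> and \<open>d\<close>, a map of \<open>T\<^sub>m\<close> to \<open>G\<close> that sends arrows to arrows or
  vertices amounts to a closed alternating walk along the following pairs \<open>(i, j)\<close>. The pairs with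
  \<open>i = a\<close>, \<open>j = d\<close> or \<open>i = j\<close> carry irregular paths; they are what connects the vertices
  whose condition in \<open>Omega3_iff\<close> is void.
\<close>

definition mid :: "'v pair_pre_digraph \<Rightarrow> 'v \<Rightarrow> 'v \<Rightarrow> 'v \<Rightarrow> 'v \<Rightarrow> bool" where
  "mid G a d i j \<longleftrightarrow> (i = a \<or> (a, i) \<in> parcs G) \<and> (j = d \<or> (j, d) \<in> parcs G) \<and>
     (i = j \<or> (i, j) \<in> parcs G)"

text \<open>A step crosses two edges, \<open>b'\<close> to \<open>c\<close> to \<open>b''\<close>,
  so walks start and end at second positions. The vector is the alternating sum of the edges
  crossed. It is an argument of the relation because walks with the same ends may carry different
  vectors.\<close>

inductive conn :: "'v pair_pre_digraph \<Rightarrow> 'v \<Rightarrow> 'v \<Rightarrow> 'v \<Rightarrow> 'v \<Rightarrow> ('v list \<Rightarrow>\<^sub>0 'k::field) \<Rightarrow> bool"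
  for G a d where
  stay: "conn G a d b b 0"
| move: "conn G a d b b' v \<Longrightarrow> mid G a d b' c \<Longrightarrow> mid G a d b'' c \<Longrightarrow>
    conn G a d b b'' (v + reg_el [a, b', c, d] - reg_el [a, b'', c, d])"

lemma conn_step1:
  assumes "mid G a d b c" "mid G a d b' c"
  shows "conn G a d b b' (reg_el [a, b, c, d] - reg_el [a, b', c, d])"
  using conn.move[OF conn.stay assms] by simp

lemma conn_trans: "conn G a d b' b'' w \<Longrightarrow> conn G a d b b' v \<Longrightarrow> conn G a d b b'' (v + w)"
proof (induction rule: conn.induct)
  case (move x y w c z)
  have "conn G a d b z (v + w + reg_el [a, y, c, d] - reg_el [a, z, c, d])"
    using move.IH[OF move.prems] move.hyps(2,3) by (rule conn.move)
  then show ?case by (simp add: algebra_simps)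
qed simp

lemma conn_sym: "conn G a d b b' v \<Longrightarrow> conn G a d b' b (- v)"
proof (induction rule: conn.induct)
  case (move x y w c z)
  have "conn G a d z x ((reg_el [a, z, c, d] - reg_el [a, y, c, d]) + - w)"
    using move.IH conn_step1[OF move.hyps(3,2)] by (rule conn_trans)
  then show ?case by (simp add: algebra_simps)
qed (simp add: conn.stay)

text \<open>Brings a walk into the index form of \<open>trap_path\<close>. Writing
  \<open>i (Suc k)\<close> without \<open>mod m\<close> admits open walks, which the induction
  passes through.\<close>

lemma conn_cyclic_sequences:
  "conn G a d b b' v \<Longrightarrow> \<exists>m i j. i 0 = b \<and> i m = b' \<and>
     (\<forall>k<m. mid G a d (i k) (j k) \<and> mid G a d (i (Suc k)) (j k)) \<and>
     v = (\<Sum>k<m. reg_el [a, i k, j k, d] - reg_el [a, i (Suc k), j k, d])"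
proof (induction rule: conn.induct)
  case (stay b)
  show ?case by (rule exI[of _ 0]) auto
next
  case (move b b' v c b'')
  then obtain m i j where ij: "i 0 = b" "i m = b'"
    "\<forall>k<m. mid G a d (i k) (j k) \<and> mid G a d (i (Suc k)) (j k)"
    "v = (\<Sum>k<m. reg_el [a, i k, j k, d] - reg_el [a, i (Suc k), j k, d])"
    by blast
  have "(\<Sum>k<m. reg_el [a, (i(Suc m := b'')) k, (j(m := c)) k, d] - reg_el [a, (i(Suc m := b'')) (Suc k), (j(m := c)) k, d]) = v"
    unfolding ij(4) by (rule sum.cong) auto
  then show ?case
    using ij move.hyps(2,3)
    by (intro exI[of _ "Suc m"] exI[of _ "i(Suc m := b'')"] exI[of _ "j(m := c)"])
      (auto simp: less_Suc_eq algebra_simps)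
qed

lemma push_diff: "push f (u - v) = push f u - push f v"
proof -
  have "push f (u - v) = push f (u + scl (- 1) v)" by simp
  also have "\<dots> = push f u + scl (- 1) (push f v)"
    unfolding push_def lin_ext_add lin_ext_scl ..
  finally show ?thesis by simp
qed

lemma push_sum: "push f (sum h S) = (\<Sum>x\<in>S. push f (h x))"
  by (simp add: push_def lin_ext_sum)

lemma push_el: "push f (el xs) = reg_el (map f xs)"
  by (simp add: push_def)

text \<open>The poles of \<open>T_m\<close> go to \<open>a\<close> and \<open>d\<close>, the other
  vertices to those of the walk. \<open>mid\<close> allows equality as well as an arrow, so arrows
  of \<open>T_m\<close> may collapse; \<open>Y\<close> is the image without the loops that
  result.\<close>

lemma closed_conn_merging_image:
  fixes v :: "'v list \<Rightarrow>\<^sub>0 'k::field"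
  assumes G: "pair_loopfree_digraph G" and "conn G a d b b v" "v \<noteq> 0"
    and ad: "a \<in> pverts G" "d \<in> pverts G"
  shows "v \<in> merging_images G"
proof -
  interpret pair_loopfree_digraph G by fact
  obtain m i j where ij: "i 0 = b" "i m = b"
    "\<forall>k<m. mid G a d (i k) (j k) \<and> mid G a d (i (Suc k)) (j k)"
    and v: "v = (\<Sum>k<m. reg_el [a, i k, j k, d] - reg_el [a, i (Suc k), j k, d])"
    using conn_cyclic_sequences[OF assms(2)] by blast
  \<comment> \<open>A closed walk of at most one step has the vector 0, its two edges being
    equal.\<close>
  have m: "m \<ge> 2"
  proof (rule ccontr)
    assume "\<not> m \<ge> 2"
    then have "m = 0 \<or> m = Suc 0" by auto
    then have "v = 0" using ij(1,2) unfolding v by auto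
    then show False using assms(3) by simp
  qed
  have imod: "i (Suc k mod m) = i (Suc k)" if "k < m" for k
    using that ij(1,2) by (cases "Suc k = m") auto
  define f where "f x = (case x of TA \<Rightarrow> a | TB \<Rightarrow> d | TI k \<Rightarrow> i k | TJ k \<Rightarrow> j k)" for x
  define T where "T = trapezohedron m"
  define Y where "Y = \<lparr> pverts = f ` pverts T, parcs = {(f x, f y) | x y. (x, y) \<in> parcs T \<and> f x \<noteq> f y} \<rparr>"
  have Tarcs: "x \<in> pverts T \<and> y \<in> pverts T \<and> (f x = f y \<or> (f x, f y) \<in> parcs G)" if "(x, y) \<in> parcs T" for x y
    using that m ij(3) imod unfolding T_def trapezohedron_def f_def mid_def
    by auto
  have Tverts: "f x \<in> pverts G" if "x \<in> pverts T" for x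
  proof -
    have "i k \<in> pverts G" "j k \<in> pverts G" if "k < m" for k
      using ij(3) that ad unfolding mid_def by (metis in_arcsD1 in_arcsD2)+
    then show ?thesis
      using that ad by (auto simp: T_def trapezohedron_def f_def)
  qed
  have loopY: "pair_loopfree_digraph Y"
    by unfold_locales (use Tarcs in \<open>auto simp: Y_def\<close>)
  moreover have "subgraph (with_proj Y) (with_proj G)"
  proof -
    interpret Y: pair_loopfree_digraph Y by (rule loopY)
    have "pverts Y \<subseteq> pverts G" "parcs Y \<subseteq> parcs G"
      using Tarcs Tverts by (auto simp: Y_def)
    then show ?thesis
      by (auto simp: subgraph_def compatible_def wf_digraph Y.wf_digraph)
  qed
  moreover have "merging_map T Y f"
    unfolding merging_map_def using Tarcs by (fastforce simp: Y_def)
  moreover have "push f (trap_path m) = v"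
    unfolding v trap_path_def push_sum push_diff push_el
    by (rule sum.cong) (auto simp: f_def imod)
  ultimately show ?thesis
    using m unfolding merging_images_def T_def by blast
qed

section \<open>Conservation along walks\<close>

lemma mass_reg_el: "mass S (reg_el xs) = (if xs \<in> S \<and> \<not> irregular xs then 1 else 0)"
  by (simp add: reg_el_def)

text \<open>At a vertex that carries a condition all edges of the walk are regular: for
  \<open>[a, x, c, d]\<close>, either of \<open>x = c\<close> and \<open>c = d\<close> would force
  \<open>x = d\<close> or \<open>x -> d\<close>. So a passage through \<open>x\<close> cancels and
  only the ends of the walk count. At a third position the two edges of a step meet and
  cancel.\<close>

lemma conn_conditions:
  fixes v :: "'v list \<Rightarrow>\<^sub>0 'k::field"
  assumes G: "pair_loopfree_digraph G" and "conn G a d b b' v"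
  shows "Poly_Mapping.keys v \<subseteq> allowed_paths 3 G \<and>
    (\<forall>x. x \<noteq> d \<longrightarrow> (x, d) \<notin> parcs G \<longrightarrow> (a, x) \<in> parcs G \<longrightarrow>
      mass (via1 a x d) v = (if x = b then 1 else 0) - (if x = b' then 1 else 0)) \<and>
    (\<forall>y. y \<noteq> a \<longrightarrow> (a, y) \<notin> parcs G \<longrightarrow> (y, d) \<in> parcs G \<longrightarrow> mass (via2 a y d) v = 0)"
proof -
  interpret pair_loopfree_digraph G by fact
  have nl: "(x, x) \<notin> parcs G" for x using no_loops by force
  show ?thesis
    using assms(2)
  proof (induction rule: conn.induct)
    case (move b b' v c b'')
    have reg: "Poly_Mapping.keys (reg_el [a, x, c, d] :: 'v list \<Rightarrow>\<^sub>0 'k) \<subseteq> allowed_paths 3 G"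
      if "mid G a d x c" for x
      using that by (auto simp: reg_el_def irregular_4 allowed3_iff[OF G] mid_def)
    have keys: "Poly_Mapping.keys (v + reg_el [a, b', c, d] - reg_el [a, b'', c, d]) \<subseteq> allowed_paths 3 G"
      using move.IH reg[OF move.hyps(2)] reg[OF move.hyps(3)]
        keys_diff[of "v + reg_el [a, b', c, d]" "reg_el [a, b'', c, d]"] keys_add[of v "reg_el [a, b', c, d]"]
      by blast
    have L: "mass (via1 a x d) (v + reg_el [a, b', c, d] - reg_el [a, b'', c, d]) =
        (if x = b then 1 else 0) - (if x = b'' then 1 else 0)"
      if x: "x \<noteq> d" "(x, d) \<notin> parcs G" "(a, x) \<in> parcs G" for x
    proof -
      have "\<not> irregular [a, x, c, d]" if "mid G a d x c"
        using that x nl by (auto simp: irregular_4 mid_def)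
      then show ?thesis using move.IH move.hyps(2,3) x by (auto simp: mass_reg_el)
    qed
    have R: "mass (via2 a y d) (v + reg_el [a, b', c, d] - reg_el [a, b'', c, d]) = 0"
      if y: "y \<noteq> a" "(a, y) \<notin> parcs G" "(y, d) \<in> parcs G" for y
    proof -
      have "\<not> irregular [a, x, y, d]" if "mid G a d x y" for x
        using that y nl by (auto simp: irregular_4 mid_def)
      then show ?thesis using move.IH move.hyps(2,3) y by (auto simp: mass_reg_el)
    qed
    show ?case using keys L R by (intro conjI allI impI)
  qed auto
qed

lemma keys_conn:
  fixes v :: "'v list \<Rightarrow>\<^sub>0 'k::field"
  shows "conn G a d b b' v \<Longrightarrow> Poly_Mapping.keys v \<subseteq> {[a, b, c, d] | b c. True}"
proof (induction rule: conn.induct)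
  case (move b b' v c b'')
  have "Poly_Mapping.keys (reg_el [a, x, c, d] :: 'v list \<Rightarrow>\<^sub>0 'k) \<subseteq> {[a, b, c, d] | b c. True}" for x
    by (auto simp: reg_el_def)
  then show ?case
    using move.IH keys_diff[of "v + reg_el [a, b', c, d]" "reg_el [a, b'', c, d]"]
      keys_add[of v "reg_el [a, b', c, d]"]
    by (meson Un_least subset_trans)
qed (simp only: keys_zero empty_subsetI)

lemma closed_conn_Omega:
  assumes G: "pair_loopfree_digraph G" and c: "conn G a d b b v"
  shows "v \<in> Omega 3 G"
proof -
  note k = keys_conn[OF c] and cc = conn_conditions[OF G c]
  note cc1 = cc[THEN conjunct2, THEN conjunct1, rule_format]
    and cc2 = cc[THEN conjunct2, THEN conjunct2, rule_format]
  have "mass (via1 a' x d') v = 0" if "x \<noteq> d'" "(x, d') \<notin> parcs G" for a' x d'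
  proof (cases "a' = a \<and> d' = d \<and> (a, x) \<in> parcs G")
    case True
    then show ?thesis using cc1[of x] that by simp
  next
    case False
    show ?thesis
    proof (rule mass_eq_0, rule ccontr)
      assume "Poly_Mapping.keys v \<inter> via1 a' x d' \<noteq> {}"
      then obtain y where y: "[a', x, y, d'] \<in> Poly_Mapping.keys v" by (auto simp: via1_def)
      then have "a' = a" "d' = d" using subsetD[OF k y] by auto
      moreover have "[a', x, y, d'] \<in> allowed_paths 3 G" using subsetD[OF conjunct1[OF cc] y] .
      ultimately show False using False by (auto simp: allowed3_iff[OF G])
    qed
  qed
  moreover have "mass (via2 a' x d') v = 0" if "a' \<noteq> x" "(a', x) \<notin> parcs G" for a' x d'
  proof (cases "a' = a \<and> d' = d \<and> (x, d) \<in> parcs G")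
    case True
    then show ?thesis using cc2[of x] that by simp
  next
    case False
    show ?thesis
    proof (rule mass_eq_0, rule ccontr)
      assume "Poly_Mapping.keys v \<inter> via2 a' x d' \<noteq> {}"
      then obtain y where y: "[a', y, x, d'] \<in> Poly_Mapping.keys v" by (auto simp: via2_def)
      then have "a' = a" "d' = d" using subsetD[OF k y] by auto
      moreover have "[a', y, x, d'] \<in> allowed_paths 3 G" using subsetD[OF conjunct1[OF cc] y] .
      ultimately show False using False by (auto simp: allowed3_iff[OF G])
    qed
  qed
  ultimately show ?thesis
    unfolding Omega3_iff[OF G] using conjunct1[OF cc] by blast
qed

text \<open>
  Potentials \<open>P\<close>, \<open>Q\<close> on the inner vertices that vanish where the conditions are void turn
  \<open>u = \<Sum> u\<^sub>e e\<close> into \<open>u = \<Sum> u\<^sub>e (e + P - Q)\<close>.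
\<close>

lemma Omega3_in_span_potential:
  fixes u :: "'v list \<Rightarrow>\<^sub>0 'k::field"
  assumes G: "pair_loopfree_digraph G" and u: "u \<in> Omega 3 G"
    and P: "\<And>a b d. b = d \<or> (b, d) \<in> parcs G \<Longrightarrow> P a b d = 0"
    and Q: "\<And>a c d. a = c \<or> (a, c) \<in> parcs G \<Longrightarrow> Q a c d = 0"
    and S: "\<And>a b c d. [a, b, c, d] \<in> allowed_paths 3 G \<Longrightarrow> el [a, b, c, d] + P a b d - Q a c d \<in> pv.span S"
  shows "u \<in> pv.span S"
proof -
  let ?K = "Poly_Mapping.keys u"
  define p where "p xs = P (xs ! 0) (xs ! 1) (xs ! 3)" for xs
  define q where "q xs = Q (xs ! 0) (xs ! 2) (xs ! 3)" for xs
  have K: "?K \<subseteq> allowed_paths 3 G" using u Omega3_iff[OF G] by blast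
  have p0: "(\<Sum>xs\<in>?K. scl (lkp u xs) (p xs)) = 0"
  proof -
    \<comment> \<open>Grouping the keys by \<open>(a, b, d)\<close> turns the sum into masses times
      \<open>P a b d\<close>. In each product one factor is 0: the mass if the condition is present,
      \<open>P\<close> if it is void.\<close>
    define g where "g xs = (xs ! 0, xs ! 1, xs ! 3)" for xs :: "'v list"
    have "(\<Sum>xs\<in>?K. scl (lkp u xs) (p xs)) = (\<Sum>t\<in>g ` ?K. \<Sum>xs | xs \<in> ?K \<and> g xs = t. scl (lkp u xs) (p xs))"
      by (simp add: sum.image_gen[of ?K _ g])
    also have "\<dots> = 0"
    proof (rule sum.neutral, rule ballI)
      fix t assume "t \<in> g ` ?K"
      obtain a b d where t: "t = (a, b, d)" by (cases t)
      have "(\<Sum>xs | xs \<in> ?K \<and> g xs = t. scl (lkp u xs) (p xs)) = (\<Sum>xs | xs \<in> ?K \<and> g xs = t. scl (lkp u xs) (P a b d))"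
        by (rule sum.cong) (auto simp: p_def g_def t)
      also have "\<dots> = scl (\<Sum>xs | xs \<in> ?K \<and> g xs = t. lkp u xs) (P a b d)"
        by (simp add: pv.scale_sum_left)
      also have "(\<Sum>xs | xs \<in> ?K \<and> g xs = t. lkp u xs) = mass (via1 a b d) u"
        unfolding mass_def sum.inter_filter[OF finite_keys]
      proof (rule sum.cong[OF refl])
        fix xs assume "xs \<in> ?K"
        then obtain a' b' c' d' where "xs = [a', b', c', d']" using K allowed3_iff[OF G] by blast
        then show "(if g xs = t then lkp u xs else 0) = (if xs \<in> via1 a b d then lkp u xs else 0)"
          by (auto simp: g_def t)
      qed
      also have "scl \<dots> (P a b d) = 0"
        using u P[of b d a] unfolding Omega3_iff[OF G] by (metis pv.scale_eq_0_iff)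
      finally show "(\<Sum>xs | xs \<in> ?K \<and> g xs = t. scl (lkp u xs) (p xs)) = 0" .
    qed
    finally show ?thesis .
  qed
  have q0: "(\<Sum>xs\<in>?K. scl (lkp u xs) (q xs)) = 0"
  proof -
    define g where "g xs = (xs ! 0, xs ! 2, xs ! 3)" for xs :: "'v list"
    have "(\<Sum>xs\<in>?K. scl (lkp u xs) (q xs)) = (\<Sum>t\<in>g ` ?K. \<Sum>xs | xs \<in> ?K \<and> g xs = t. scl (lkp u xs) (q xs))"
      by (simp add: sum.image_gen[of ?K _ g])
    also have "\<dots> = 0"
    proof (rule sum.neutral, rule ballI)
      fix t assume "t \<in> g ` ?K"
      obtain a c d where t: "t = (a, c, d)" by (cases t)
      have "(\<Sum>xs | xs \<in> ?K \<and> g xs = t. scl (lkp u xs) (q xs)) = (\<Sum>xs | xs \<in> ?K \<and> g xs = t. scl (lkp u xs) (Q a c d))"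
        by (rule sum.cong) (auto simp: q_def g_def t)
      also have "\<dots> = scl (\<Sum>xs | xs \<in> ?K \<and> g xs = t. lkp u xs) (Q a c d)"
        by (simp add: pv.scale_sum_left)
      also have "(\<Sum>xs | xs \<in> ?K \<and> g xs = t. lkp u xs) = mass (via2 a c d) u"
        unfolding mass_def sum.inter_filter[OF finite_keys]
      proof (rule sum.cong[OF refl])
        fix xs assume "xs \<in> ?K"
        then obtain a' b' c' d' where "xs = [a', b', c', d']" using K allowed3_iff[OF G] by blast
        then show "(if g xs = t then lkp u xs else 0) = (if xs \<in> via2 a c d then lkp u xs else 0)"
          by (auto simp: g_def t)
      qed
      also have "scl \<dots> (Q a c d) = 0"
        using u Q[of a c d] unfolding Omega3_iff[OF G] by (metis pv.scale_eq_0_iff)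
      finally show "(\<Sum>xs | xs \<in> ?K \<and> g xs = t. scl (lkp u xs) (q xs)) = 0" .
    qed
    finally show ?thesis .
  qed
  have "u = (\<Sum>xs\<in>?K. scl (lkp u xs) (el xs))" by (simp add: sum_el)
  also have "\<dots> = (\<Sum>xs\<in>?K. scl (lkp u xs) (el xs + p xs - q xs))"
    using p0 q0 by (simp add: pv.scale_right_distrib pv.scale_right_diff_distrib sum.distrib sum_subtractf)
  also have "\<dots> \<in> pv.span S"
  proof (rule pv.span_sum, rule pv.span_scale)
    fix xs assume xs: "xs \<in> ?K"
    then obtain a b c d where "xs = [a, b, c, d]" using K allowed3_iff[OF G] by blast
    then show "el xs + p xs - q xs \<in> pv.span S"
      using S[of a b c d] xs K by (auto simp: p_def q_def)
  qed
  finally show ?thesis .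
qed

text \<open>\<open>P a b d\<close> is the vector of a walk from the root of the component to
  \<open>b\<close>, and \<open>Q a c d\<close> that of a walk prolonged by an edge into
  \<open>c\<close>. The corrected edge is then a closed walk: from the root to \<open>b\<close>,
  through \<open>c\<close> to the chosen neighbour of \<open>c\<close>, and back.\<close>

lemma Omega3_span_merging_images:
  fixes G :: "'v pair_pre_digraph"
  assumes G: "pair_loopfree_digraph G"
  shows "pv.span (merging_images G \<inter> Omega 3 G) = (Omega 3 G :: ('v list \<Rightarrow>\<^sub>0 'k::field) set)"
proof
  show "pv.span (merging_images G \<inter> Omega 3 G) \<subseteq> (Omega 3 G :: ('v list \<Rightarrow>\<^sub>0 'k) set)"
    by (rule pv.span_minimal) (auto intro: subspace_Omega3[OF G])
next
  interpret pair_loopfree_digraph G by fact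
  let ?S = "merging_images G \<inter> (Omega 3 G :: ('v list \<Rightarrow>\<^sub>0 'k) set)"
  define gnd where "gnd d b \<longleftrightarrow> b = d \<or> (b, d) \<in> parcs G" for b d
  define C where "C a d b b' \<longleftrightarrow> (\<exists>v :: 'v list \<Rightarrow>\<^sub>0 'k. conn G a d b b' v)" for a d b b'
  \<comment> \<open>The root is taken among the vertices without a condition if the component has
    any. All of these are joined through \<open>d\<close> by irregular edges, at cost 0, so
    \<open>P\<close> can vanish at each of them.\<close>
  define root where "root a d b =
    (if \<exists>x. C a d b x \<and> gnd d x \<and> (x = a \<or> (a, x) \<in> parcs G) then SOME x. C a d b x \<and> gnd d x \<and> (x = a \<or> (a, x) \<in> parcs G)
     else SOME x. C a d b x)" for a d b
  have C_refl: "C a d b b" for a d b unfolding C_def by (blast intro: conn.stay)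
  have C_sym: "C a d b b' \<Longrightarrow> C a d b' b" for a d b b' unfolding C_def by (blast intro: conn_sym)
  have C_trans: "C a d b b' \<Longrightarrow> C a d b' b'' \<Longrightarrow> C a d b b''" for a d b b' b''
    unfolding C_def by (blast intro: conn_trans)
  have root_eq: "root a d b = root a d b'" if "C a d b b'" for a d b b'
  proof -
    have eq: "C a d b = C a d b'" using that C_sym C_trans by blast
    show ?thesis unfolding root_def eq ..
  qed
  have C_root: "C a d (root a d b) b" for a d b
  proof (cases "\<exists>x. C a d b x \<and> gnd d x \<and> (x = a \<or> (a, x) \<in> parcs G)")
    case True
    then show ?thesis unfolding root_def if_P[OF True] using someI_ex[OF True] C_sym by blast
  next
    case False
    then show ?thesis unfolding root_def if_not_P[OF False] using someI[of "C a d b", OF C_refl] C_sym by blast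
  qed
  have gnd0: "conn G a d x y (0 :: 'v list \<Rightarrow>\<^sub>0 'k)" if "gnd d x" "gnd d y" "x = a \<or> (a, x) \<in> parcs G" "y = a \<or> (a, y) \<in> parcs G"
    for a d x y
    using conn_step1[of G a d x d y] that
    by (auto simp: mid_def gnd_def reg_el_def irregular_4)
  have root_gnd: "conn G a d (root a d b) b (0 :: 'v list \<Rightarrow>\<^sub>0 'k)"
    if b: "gnd d b" "b = a \<or> (a, b) \<in> parcs G" for a d b
  proof -
    have ex: "\<exists>x. C a d b x \<and> gnd d x \<and> (x = a \<or> (a, x) \<in> parcs G)" using b C_refl by blast
    have "gnd d (root a d b) \<and> (root a d b = a \<or> (a, root a d b) \<in> parcs G)"
      using someI_ex[OF ex] ex unfolding root_def by auto
    then show ?thesis using gnd0 b by blast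
  qed
  define P :: "'v \<Rightarrow> 'v \<Rightarrow> 'v \<Rightarrow> 'v list \<Rightarrow>\<^sub>0 'k" where
    "P a b d = (if gnd d b then 0 else SOME v. conn G a d (root a d b) b v)" for a b d
  have P: "conn G a d (root a d b) b (P a b d)" if "b = a \<or> (a, b) \<in> parcs G" for a b d
  proof (cases "gnd d b")
    case True
    then show ?thesis using root_gnd[OF True that] by (simp add: P_def)
  next
    case False
    then show ?thesis
      using someI_ex[of "conn G a d (root a d b) b"] C_root[of a d b] by (simp add: P_def C_def)
  qed
  \<comment> \<open>If \<open>c\<close> carries no condition, \<open>c\<close> itself serves as
    neighbour: \<open>[a, c, c, d]\<close> is irregular, and for \<open>c -> d\<close> also
    \<open>P a c d = 0\<close>. So \<open>Q = 0\<close> there agrees with the general formula, as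
    \<open>Qn\<close> confirms.\<close>
  define nb where "nb a c d = (if a = c \<or> (a, c) \<in> parcs G then c else SOME b. mid G a d b c)" for a c d
  define Q :: "'v \<Rightarrow> 'v \<Rightarrow> 'v \<Rightarrow> 'v list \<Rightarrow>\<^sub>0 'k" where
    "Q a c d = (if a = c \<or> (a, c) \<in> parcs G then 0 else P a (nb a c d) d + reg_el [a, nb a c d, c, d])" for a c d
  show "(Omega 3 G :: ('v list \<Rightarrow>\<^sub>0 'k) set) \<subseteq> pv.span ?S"
  proof
    fix u :: "'v list \<Rightarrow>\<^sub>0 'k" assume u: "u \<in> Omega 3 G"
    then show "u \<in> pv.span ?S"
    proof (rule Omega3_in_span_potential[OF G, where P = P and Q = Q])
      fix a b c d assume "[a, b, c, d] \<in> allowed_paths 3 G"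
      then have arcs: "(a, b) \<in> parcs G" "(b, c) \<in> parcs G" "(c, d) \<in> parcs G"
        using allowed3_iff[OF G] by auto
      have el: "el [a, b, c, d] = (reg_el [a, b, c, d] :: 'v list \<Rightarrow>\<^sub>0 'k)"
        using arcs no_loops by (fastforce simp: reg_el_def irregular_4)
      have mb: "mid G a d b c" using arcs by (auto simp: mid_def)
      have mn: "mid G a d (nb a c d) c"
        using someI[of "\<lambda>b. mid G a d b c", OF mb] arcs by (auto simp: nb_def mid_def)
      have Qn: "Q a c d = P a (nb a c d) d + reg_el [a, nb a c d, c, d]"
        using arcs by (auto simp: Q_def nb_def P_def gnd_def reg_el_def irregular_4)
      have bn: "conn G a d b (nb a c d) (reg_el [a, b, c, d] - reg_el [a, nb a c d, c, d] :: 'v list \<Rightarrow>\<^sub>0 'k)"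
        using mb mn by (rule conn_step1)
      then have r: "root a d b = root a d (nb a c d)"
        by (intro root_eq) (auto simp: C_def)
      have "conn G a d (root a d b) (nb a c d) (P a b d + (reg_el [a, b, c, d] - reg_el [a, nb a c d, c, d]))"
        using arcs by (intro conn_trans[OF bn] P) blast
      moreover have "conn G a d (nb a c d) (root a d b) (- P a (nb a c d) d)"
        unfolding r using mn by (intro conn_sym P) (auto simp: mid_def)
      ultimately have "conn G a d (root a d b) (root a d b)
          (P a b d + (reg_el [a, b, c, d] - reg_el [a, nb a c d, c, d]) + - P a (nb a c d) d)"
        by (rule conn_trans[rotated])
      then have c: "conn G a d (root a d b) (root a d b) (el [a, b, c, d] + P a b d - Q a c d)"
        unfolding Qn el by (simp add: algebra_simps)
      have "a \<in> pverts G" "d \<in> pverts G" using arcs in_arcsD1 in_arcsD2 by auto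
      then show "el [a, b, c, d] + P a b d - Q a c d \<in> pv.span ?S"
        using closed_conn_merging_image[OF G c] closed_conn_Omega[OF G c]
        by (cases "el [a, b, c, d] + P a b d - Q a c d = 0") (auto intro: pv.span_base pv.span_zero)
    qed (auto simp: P_def Q_def gnd_def)
  qed
qed

text \<open>Every spanning set contains a basis, in infinite dimension too.\<close>

lemma Omega3_basis_of_merging_images:
  assumes "pair_loopfree_digraph G"
  shows "\<exists>B :: ('v list \<Rightarrow>\<^sub>0 'k::field) set. B \<subseteq> merging_images G \<and> is_basis B (Omega 3 G)"
proof -
  let ?S = "merging_images G \<inter> (Omega 3 G :: ('v list \<Rightarrow>\<^sub>0 'k) set)"
  obtain B where B: "B \<subseteq> ?S" "pv.independent B" "?S \<subseteq> pv.span B"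
    using pv.maximal_independent_subset[of ?S] by blast
  have "pv.span B = pv.span ?S"
    using B(1,3) pv.span_mono[OF B(1)] pv.span_minimal[OF B(3)] by blast
  then show ?thesis
    using B(1,2) Omega3_span_merging_images[OF assms] unfolding is_basis_def by blast
qed

section \<open>One step of the algorithm\<close>

text \<open>
  Fix the end vertices \<open>a\<close> and \<open>d\<close>. The nodes \<open>x < 2 * n\<close> of an auxiliary bipartite graph are the
  vertices in second position (\<open>b\<close>, numbered \<open>b\<close>) and in third position (\<open>c\<close>, numbered \<open>n + c\<close>);
  its edges are the allowed paths \<open>[a, b, c, d]\<close>. Active are the nodes that carry a condition
  of \<open>Omega3_iff\<close>.
\<close>

locale end_pair =
  fixes H :: "nat pair_pre_digraph" and n a d :: nat
  assumes H: "pair_loopfree_digraph H" and verts: "pverts H = {..<n}"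
begin

definition active :: "nat \<Rightarrow> bool" where
  "active x \<longleftrightarrow> (if x < n then x \<noteq> d \<and> (x, d) \<notin> parcs H else x - n \<noteq> a \<and> (a, x - n) \<notin> parcs H)"

text \<open>The sign at third positions orients each edge from \<open>b\<close> to
  \<open>n + c\<close>: it has flow 1 at one end and -1 at the other.\<close>

definition flow :: "nat \<Rightarrow> (nat list \<Rightarrow>\<^sub>0 'k::field) \<Rightarrow> 'k" where
  "flow x u = (if x < n then mass (via1 a x d) u else - mass (via2 a (x - n) d) u)"

definition edge :: "nat \<Rightarrow> nat \<Rightarrow> bool" where
  "edge b c \<longleftrightarrow> (a, b) \<in> parcs H \<and> (b, c) \<in> parcs H \<and> (c, d) \<in> parcs H"

lemma edge_less: "edge b c \<Longrightarrow> b < n \<and> c < n"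
proof -
  interpret pair_loopfree_digraph H by (rule H)
  show "edge b c \<Longrightarrow> b < n \<and> c < n"
    using verts in_arcsD1 in_arcsD2 unfolding edge_def by blast
qed

lemma edge_allowed: "[a, b, c, d] \<in> allowed_paths 3 H \<longleftrightarrow> edge b c"
  by (simp add: allowed3_iff[OF H] edge_def)

lemma flow_linear [simp]:
  "flow x (u + v) = flow x u + flow x v" "flow x (u - v) = flow x u - flow x v"
  "flow x (scl k u) = k * flow x u" "flow x 0 = 0" "flow x (- u) = - flow x u"
  by (auto simp: flow_def)

lemma flow_el [simp]:
  "b < n \<Longrightarrow> c < n \<Longrightarrow> flow x (el [a, b, c, d]) = (if x = b then 1 else 0) - (if x = n + c then 1 else 0)"
  by (auto simp: flow_def)

lemma Omega3_flow:
  assumes k: "Poly_Mapping.keys u \<subseteq> {[a, b, c, d] | b c. edge b c}"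
    and f: "\<And>x. x < 2 * n \<Longrightarrow> active x \<Longrightarrow> flow x u = 0"
  shows "u \<in> Omega 3 H"
proof -
  have "mass (via1 a' x d') u = 0" if x: "x \<noteq> d'" "(x, d') \<notin> parcs H" for a' x d'
  proof (cases "a' = a \<and> d' = d \<and> x < n")
    case True
    then show ?thesis using f[of x] x by (auto simp: active_def flow_def)
  next
    case False
    show ?thesis
    proof (rule mass_eq_0, rule ccontr)
      assume "Poly_Mapping.keys u \<inter> via1 a' x d' \<noteq> {}"
      then obtain y where "[a', x, y, d'] \<in> Poly_Mapping.keys u" by (auto simp: via1_def)
      then have "a' = a" "d' = d" "edge x y" using subsetD[OF k, of "[a', x, y, d']"] by auto
      then show False using False edge_less by blast
    qed
  qed
  moreover have "mass (via2 a' x d') u = 0" if x: "a' \<noteq> x" "(a', x) \<notin> parcs H" for a' x d'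
  proof (cases "a' = a \<and> d' = d \<and> x < n")
    case True
    then show ?thesis using f[of "n + x"] x by (auto simp: active_def flow_def)
  next
    case False
    show ?thesis
    proof (rule mass_eq_0, rule ccontr)
      assume "Poly_Mapping.keys u \<inter> via2 a' x d' \<noteq> {}"
      then obtain y where "[a', y, x, d'] \<in> Poly_Mapping.keys u" by (auto simp: via2_def)
      then have "a' = a" "d' = d" "edge y x" using subsetD[OF k, of "[a', y, x, d']"] by auto
      then show False using False edge_less by blast
    qed
  qed
  moreover have "Poly_Mapping.keys u \<subseteq> allowed_paths 3 H"
    using k edge_allowed by blast
  ultimately show ?thesis unfolding Omega3_iff[OF H] by blast
qed

text \<open>
  \<open>pot\<close> gives for each node \<open>x\<close> a combination of tree edges whose flow is a source at \<open>x\<close> and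
  a sink at the root of its component. A label is \<open>Suc\<close> of the root, or \<open>0\<close> for the component of
  the inactive nodes, where flow may vanish.
\<close>

definition pot :: "nat \<Rightarrow> (nat \<Rightarrow> nat) \<Rightarrow> (nat \<Rightarrow> nat) \<Rightarrow> (nat \<Rightarrow> nat \<Rightarrow> 'k) \<Rightarrow> nat \<Rightarrow> (nat list \<Rightarrow>\<^sub>0 'k::field)" where
  "pot nt tb tc P x = (\<Sum>j<nt. scl (P x j) (el [a, tb j, tc j, d]))"

text \<open>The clause on \<open>Q\<close> puts the fundamental cycle of every treated edge into the
  span of the output; for a tree edge this cycle is 0. The last clause bounds the number of tree
  edges, since each merge destroys a root. Flow is prescribed at active nodes only, so vectors of
  the component labelled \<open>0\<close> may end at any inactive node.\<close>

definition forest :: "(nat \<times> nat) set \<Rightarrow> (nat list \<Rightarrow>\<^sub>0 'k::field) set \<Rightarrow> nat \<Rightarrow> (nat \<Rightarrow> nat) \<Rightarrow>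
    (nat \<Rightarrow> nat \<Rightarrow> 'k) \<Rightarrow> (nat \<Rightarrow> nat) \<Rightarrow> (nat \<Rightarrow> nat) \<Rightarrow> bool" where
  "forest Q W nt lab P tb tc \<longleftrightarrow>
    (\<forall>x<2*n. \<not> active x \<longrightarrow> lab x = 0 \<and> pot nt tb tc P x = 0) \<and>
    (\<forall>x<2*n. lab x = 0 \<or> (\<exists>y<2*n. lab x = Suc y \<and> lab y = Suc y)) \<and>
    (\<forall>x<2*n. \<forall>y<2*n. active y \<longrightarrow>
      flow y (pot nt tb tc P x) = (if x = y then 1 else 0) - (if lab x = Suc y then 1 else 0)) \<and>
    (\<forall>(b, c)\<in>Q. edge b c \<and> lab b = lab (n + c) \<and>
      el [a, b, c, d] - pot nt tb tc P b + pot nt tb tc P (n + c) \<in> pv.span W) \<and>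
    (\<forall>j<nt. (tb j, tc j) \<in> Q) \<and> inj_on (\<lambda>j. (tb j, tc j)) {..<nt} \<and>
    nt + card {y. y < 2*n \<and> lab y = Suc y} \<le> 2*n"

lemma forestD:
  assumes "forest Q W nt lab P tb tc"
  shows "\<And>x. x < 2*n \<Longrightarrow> \<not> active x \<Longrightarrow> lab x = 0 \<and> pot nt tb tc P x = 0"
    and "\<And>x. x < 2*n \<Longrightarrow> lab x = 0 \<or> (\<exists>y<2*n. lab x = Suc y \<and> lab y = Suc y)"
    and "\<And>x y. x < 2*n \<Longrightarrow> y < 2*n \<Longrightarrow> active y \<Longrightarrow>
      flow y (pot nt tb tc P x) = (if x = y then 1 else 0) - (if lab x = Suc y then 1 else 0)"
    and "\<And>b c. (b, c) \<in> Q \<Longrightarrow> edge b c \<and> lab b = lab (n + c) \<and>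
      el [a, b, c, d] - pot nt tb tc P b + pot nt tb tc P (n + c) \<in> pv.span W"
    and "\<And>j. j < nt \<Longrightarrow> (tb j, tc j) \<in> Q" and "inj_on (\<lambda>j. (tb j, tc j)) {..<nt}"
    and "nt + card {y. y < 2*n \<and> lab y = Suc y} \<le> 2*n"
proof -
  note A = assms[unfolded forest_def]
  note A2 = A[THEN conjunct2] note A3 = A2[THEN conjunct2] note A4 = A3[THEN conjunct2]
  note A5 = A4[THEN conjunct2] note A6 = A5[THEN conjunct2]
  show "\<And>x. x < 2*n \<Longrightarrow> \<not> active x \<Longrightarrow> lab x = 0 \<and> pot nt tb tc P x = 0"
    by (rule A[THEN conjunct1, rule_format])
  show "\<And>x. x < 2*n \<Longrightarrow> lab x = 0 \<or> (\<exists>y<2*n. lab x = Suc y \<and> lab y = Suc y)"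
    by (rule A2[THEN conjunct1, rule_format])
  show "\<And>x y. x < 2*n \<Longrightarrow> y < 2*n \<Longrightarrow> active y \<Longrightarrow>
      flow y (pot nt tb tc P x) = (if x = y then 1 else 0) - (if lab x = Suc y then 1 else 0)"
    by (rule A3[THEN conjunct1, rule_format])
  show "\<And>b c. (b, c) \<in> Q \<Longrightarrow> edge b c \<and> lab b = lab (n + c) \<and>
      el [a, b, c, d] - pot nt tb tc P b + pot nt tb tc P (n + c) \<in> pv.span W"
    using A4[THEN conjunct1] by blast
  show "\<And>j. j < nt \<Longrightarrow> (tb j, tc j) \<in> Q"
    by (rule A5[THEN conjunct1, rule_format])
  show "inj_on (\<lambda>j. (tb j, tc j)) {..<nt}" by (rule A6[THEN conjunct1])
  show "nt + card {y. y < 2*n \<and> lab y = Suc y} \<le> 2*n" by (rule A6[THEN conjunct2])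
qed

text \<open>Without tree edges every \<open>pot\<close> is 0 whatever \<open>P\<close> holds, so
  entries left over from another pair of end vertices do no harm.\<close>

lemma forest_init:
  assumes "\<And>x. x < 2*n \<Longrightarrow> lab x = (if active x then Suc x else 0)"
  shows "forest {} W 0 lab P tb tc"
proof -
  have "card {y. y < 2*n \<and> lab y = Suc y} \<le> card {..<2*n}"
    by (rule card_mono) auto
  then show ?thesis using assms by (auto simp: forest_def pot_def)
qed

lemma forest_span_mono:
  assumes "forest Q W nt lab P tb tc" "pv.span W \<subseteq> pv.span W'"
  shows "forest Q W' nt lab P tb tc"
proof -
  have "z \<in> pv.span W'" if "z \<in> pv.span W" for z using assms(2) that by blast
  then show ?thesis using assms(1) unfolding forest_def by (simp add: case_prod_beta)
qed

lemma forest_nt: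
  assumes "forest Q W nt lab P tb tc"
  shows "nt \<le> 2 * n"
  using forestD(7)[OF assms] by linarith

lemma keys_pot:
  assumes "\<And>j. j < nt \<Longrightarrow> (tb j, tc j) \<in> Q"
  shows "Poly_Mapping.keys (pot nt tb tc P x) \<subseteq> (\<lambda>(b, c). [a, b, c, d]) ` Q"
proof -
  have "lkp (pot nt tb tc P x) xs = 0" if "xs \<notin> (\<lambda>(b, c). [a, b, c, d]) ` Q" for xs
    unfolding pot_def lookup_sum using that assms
    by (intro sum.neutral) (force simp: lookup_el)
  then show ?thesis by (auto simp: in_keys_iff)
qed

text \<open>The component of \<open>q\<close> is hung below \<open>p\<close>: its nodes now run to
  \<open>q\<close>, across the new edge to \<open>p\<close>, and on to the root of \<open>p\<close>,
  which adds \<open>P p - P q\<close> and the edge with sign \<open>- sg\<close>. Since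
  \<open>lab q\<close> is nonzero, inactive nodes are never moved and keep the vector 0.\<close>

lemma forest_merge:
  fixes P :: "nat \<Rightarrow> nat \<Rightarrow> 'k::field"
  assumes F: "forest Q W nt lab P tb tc" and e: "edge b c" "(b, c) \<notin> Q"
    and pq: "(p, q, sg) = (b, n + c, 1) \<or> (p, q, sg) = (n + c, b, - 1)"
    and lq: "lab q \<noteq> 0" and lpq: "lab p \<noteq> lab q"
    and lab': "\<And>x. x < 2*n \<Longrightarrow> lab' x = (if lab x = lab q then lab p else lab x)"
    and P': "\<And>x j. x < 2*n \<Longrightarrow> j < nt \<Longrightarrow> P' x j = (if lab x = lab q then P x j + (P p j - P q j) else P x j)"
    and P'nt: "\<And>x. x < 2*n \<Longrightarrow> P' x nt = (if lab x = lab q then - sg else 0)"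
    and t: "\<And>j. j < nt \<Longrightarrow> tb' j = tb j \<and> tc' j = tc j" "tb' nt = b" "tc' nt = c"
  shows "forest (insert (b, c) Q) W (Suc nt) lab' P' tb' tc'"
proof -
  let ?V = "pot nt tb tc P" and ?V' = "pot (Suc nt) tb' tc' P'" and ?e = "el [a, b, c, d] :: nat list \<Rightarrow>\<^sub>0 'k"
  note FD = forestD[OF F]
  have bc: "b < n" "c < n" using edge_less[OF e(1)] by auto
  have p: "p < 2*n" and q: "q < 2*n" using pq bc by auto
  have V': "?V' x = (if lab x = lab q then ?V x + ?V p - ?V q - scl sg ?e else ?V x)" if "x < 2*n" for x
  proof -
    have "?V' x = (\<Sum>j<nt. scl (P' x j) (el [a, tb j, tc j, d])) + scl (P' x nt) ?e"
      using t by (simp add: pot_def)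
    also have "(\<Sum>j<nt. scl (P' x j) (el [a, tb j, tc j, d])) =
        (if lab x = lab q then ?V x + ?V p - ?V q else ?V x)"
      using that by (simp add: P' pot_def pv.scale_left_distrib pv.scale_left_diff_distrib sum.distrib sum_subtractf)
    finally show ?thesis using that by (simp add: P'nt)
  qed
  have inact: "lab' x = 0 \<and> ?V' x = 0" if "x < 2*n" "\<not> active x" for x
    using FD(1)[OF that] lq lab' V' that by auto
  have roots: "lab' x = 0 \<or> (\<exists>y<2*n. lab' x = Suc y \<and> lab' y = Suc y)" if x: "x < 2*n" for x
  proof -
    define z where "z = (if lab x = lab q then p else x)"
    have z: "z < 2*n" "lab' x = lab z" using x p lab' by (auto simp: z_def)
    have "lab z \<noteq> lab q" using lpq by (auto simp: z_def)
    moreover have "lab z = 0 \<or> (\<exists>y<2*n. lab z = Suc y \<and> lab y = Suc y)" using FD(2)[OF z(1)] .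
    ultimately show ?thesis using z(2) lab' by metis
  qed
  have flow_e: "flow y (scl sg ?e) = (if y = p then 1 else 0) - (if y = q then 1 else 0)" for y
    using pq bc by auto
  have flow: "flow y (?V' x) = (if x = y then 1 else 0) - (if lab' x = Suc y then 1 else 0)"
    if x: "x < 2*n" and y: "y < 2*n" "active y" for x y
  proof -
    have f: "flow y (?V z) = (if z = y then 1 else 0) - (if lab z = Suc y then 1 else 0)" if "z < 2*n" for z
      using FD(3)[OF that y] .
    have "flow y (?V' x) = (if lab x = lab q then flow y (?V x) + flow y (?V p) - flow y (?V q) - flow y (scl sg ?e)
        else flow y (?V x))"
      by (simp add: V'[OF x] del: flow_linear(3))
    also have "\<dots> = (if x = y then 1 else 0) - (if lab' x = Suc y then 1 else 0)"
      unfolding flow_e f[OF x] f[OF p] f[OF q] lab'[OF x] using lpq by simp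
    finally show ?thesis .
  qed
  have edges: "edge b' c' \<and> lab' b' = lab' (n + c') \<and> el [a, b', c', d] - ?V' b' + ?V' (n + c') \<in> pv.span W"
    if bc': "(b', c') \<in> insert (b, c) Q" for b' c'
  proof (cases "(b', c') = (b, c)")
    case True
    have "?e - ?V' b + ?V' (n + c) = 0" "lab' b = lab' (n + c)"
      using pq lpq bc by (auto simp: V' lab')
    then show ?thesis using True e(1) by (auto simp: pv.span_zero)
  next
    case False
    then have o: "edge b' c'" "lab b' = lab (n + c')" "el [a, b', c', d] - ?V b' + ?V (n + c') \<in> pv.span W"
      using FD(4) bc' by blast+
    moreover have "b' < 2*n" "n + c' < 2*n" using edge_less[OF o(1)] by auto
    \<comment> \<open>Both ends of an old edge lie in one component, so their vectors are shifted
      alike.\<close>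
    moreover have "- ?V' b' + ?V' (n + c') = - ?V b' + ?V (n + c')"
      using o(2) V'[OF \<open>b' < 2*n\<close>] V'[OF \<open>n + c' < 2*n\<close>] by auto
    then have eq: "el [a, b', c', d] - ?V' b' + ?V' (n + c') = el [a, b', c', d] - ?V b' + ?V (n + c')"
      by (metis (no_types) add.assoc diff_conv_add_uminus)
    ultimately show ?thesis using lab' unfolding eq by auto
  qed
  have tQ: "(tb' j, tc' j) \<in> insert (b, c) Q" if "j < Suc nt" for j
    using FD(5) that t by (cases "j = nt") auto
  have inj: "inj_on (\<lambda>j. (tb' j, tc' j)) {..<Suc nt}"
  proof -
    have "inj_on (\<lambda>j. (tb' j, tc' j)) {..<nt}"
      using FD(6) t(1) by (subst inj_on_cong[of _ _ "\<lambda>j. (tb j, tc j)"]) auto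
    moreover have "(tb' nt, tc' nt) \<notin> (\<lambda>j. (tb' j, tc' j)) ` {..<nt}"
      using FD(5) t e(2) by auto
    ultimately show ?thesis by (simp add: lessThan_Suc)
  qed
  \<comment> \<open>The root of \<open>q\<close> is lost and no root is gained, which pays for the
    new tree edge in the last clause of \<open>forest\<close>.\<close>
  obtain r where r: "r < 2*n" "lab q = Suc r" "lab r = Suc r" using FD(2)[OF q] lq by auto
  have "{y. y < 2*n \<and> lab' y = Suc y} \<subseteq> {y. y < 2*n \<and> lab y = Suc y} - {r}"
  proof
    fix y assume "y \<in> {y. y < 2*n \<and> lab' y = Suc y}"
    then have y: "y < 2*n" "lab' y = Suc y" by auto
    have "lab y \<noteq> lab q"
    proof
      assume yq: "lab y = lab q"
      then have py: "lab p = Suc y" using y lab' by auto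
      then have "lab y = Suc y" using FD(2)[OF p] by auto
      then show False using py yq lpq by simp
    qed
    then show "y \<in> {y. y < 2*n \<and> lab y = Suc y} - {r}" using y lab' r by auto
  qed
  then have "card {y. y < 2*n \<and> lab' y = Suc y} \<le> card ({y. y < 2*n \<and> lab y = Suc y} - {r})"
    by (intro card_mono) auto
  also have "Suc \<dots> = card {y. y < 2*n \<and> lab y = Suc y}"
    using r by (intro card_Suc_Diff1) auto
  finally have "Suc nt + card {y. y < 2*n \<and> lab' y = Suc y} \<le> 2*n" using FD(7) by linarith
  then show ?thesis
    unfolding forest_def using inact roots flow edges tQ inj by (intro conjI allI impI ballI) (blast | simp)+
qed

end

section \<open>Independence and spanning of the fundamental cycles\<close>

text \<open>The pivot of \<open>Z t\<close> is the non-tree edge whose fundamental cycle is \<open>Z t\<close>.\<close>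

definition pivoted :: "nat pair_pre_digraph \<Rightarrow> nat list set \<Rightarrow> nat \<Rightarrow> (nat \<Rightarrow> (nat list \<Rightarrow>\<^sub>0 'k::field)) \<Rightarrow> (nat \<Rightarrow> nat list) \<Rightarrow> bool" where
  "pivoted H R dm Z piv \<longleftrightarrow> (\<forall>t<dm. Poly_Mapping.keys (Z t) \<subseteq> R \<and> Z t \<in> Omega 3 H \<and> piv t \<in> R \<and>
     (\<forall>t'<dm. lkp (Z t) (piv t') = (if t = t' then 1 else 0)))"

lemma pivoted_independent:
  assumes "pivoted H R dm Z piv"
  shows "inj_on Z {..<dm}" and "pv.independent (Z ` {..<dm})"
proof -
  have l: "lkp (Z t) (piv t') = (if t = t' then 1 else 0)" if "t < dm" "t' < dm" for t t'
    using assms that unfolding pivoted_def by blast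
  show inj: "inj_on Z {..<dm}"
    by (rule inj_onI) (metis l lessThan_iff zero_neq_one)
  show "pv.independent (Z ` {..<dm})"
  proof (rule pv.independent_if_scalars_zero)
    fix f z assume 0: "(\<Sum>v\<in>Z ` {..<dm}. scl (f v) v) = 0" and "z \<in> Z ` {..<dm}"
    then obtain t where t: "t < dm" "z = Z t" by auto
    have "0 = lkp (\<Sum>v\<in>Z ` {..<dm}. scl (f v) v) (piv t)" using 0 by simp
    also have "\<dots> = (\<Sum>t'<dm. f (Z t') * lkp (Z t') (piv t))"
      by (simp add: sum.reindex[OF inj] lookup_sum)
    also have "\<dots> = (\<Sum>t'<dm. if t' = t then f (Z t') else 0)"
      by (rule sum.cong) (use l t in auto)
    also have "\<dots> = f z" using t by simp
    finally show "f z = 0" by simp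
  qed simp
qed

context end_pair
begin

text \<open>The new pivot is a fresh edge and occurs in no earlier cycle. The new cycle consists of
  this edge and tree edges, none of which is an old pivot. Its flow vanishes at active nodes: the
  contributions of \<open>b\<close> and \<open>n + c\<close> cancel against the edge, and those of
  their common root against each other.\<close>

lemma pivoted_emit:
  fixes P :: "nat \<Rightarrow> nat \<Rightarrow> 'k::field"
  assumes F: "forest Q W nt lab P tb tc" and e: "edge b c" and lab: "lab b = lab (n + c)"
    and R: "pivoted H R dm Z piv" "[a, b, c, d] \<notin> R" "(\<lambda>(b, c). [a, b, c, d]) ` Q \<subseteq> R"
    and tree: "\<And>j t. j < nt \<Longrightarrow> t < dm \<Longrightarrow> piv t \<noteq> [a, tb j, tc j, d]"
    and Z': "\<And>t. t < dm \<Longrightarrow> Z' t = Z t"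
      "Z' dm = el [a, b, c, d] - pot nt tb tc P b + pot nt tb tc P (n + c)"
  shows "pivoted H (insert [a, b, c, d] R) (Suc dm) Z' (piv(dm := [a, b, c, d]))"
proof -
  note FD = forestD[OF F]
  have bc: "b < n" "c < n" using edge_less[OF e] by auto
  let ?V = "pot nt tb tc P"
  have kT: "Poly_Mapping.keys (?V x) \<subseteq> (\<lambda>(b, c). [a, b, c, d]) ` ((\<lambda>j. (tb j, tc j)) ` {..<nt})" for x
    by (rule keys_pot) auto
  have TQ: "(\<lambda>j. (tb j, tc j)) ` {..<nt} \<subseteq> Q" using FD(5) by auto
  have kz: "Poly_Mapping.keys (Z' dm) \<subseteq> insert [a, b, c, d] ((\<lambda>(b, c). [a, b, c, d]) ` ((\<lambda>j. (tb j, tc j)) ` {..<nt}))"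
    unfolding Z'(2)
    using keys_add[of "el [a, b, c, d] - ?V b" "?V (n + c)"] keys_diff[of "el [a, b, c, d]" "?V b"] kT[of b] kT[of "n + c"]
    by (auto simp only: keys_el)
  have "Z' dm \<in> Omega 3 H"
  proof (rule Omega3_flow)
    show "Poly_Mapping.keys (Z' dm) \<subseteq> {[a, b, c, d] | b c. edge b c}"
    proof
      fix xs assume "xs \<in> Poly_Mapping.keys (Z' dm)"
      then have "xs = [a, b, c, d] \<or> (\<exists>j<nt. xs = [a, tb j, tc j, d])" using kz by auto
      then show "xs \<in> {[a, b, c, d] | b c. edge b c}"
        using e FD(4)[OF FD(5), THEN conjunct1] by blast
    qed
    fix x assume x: "x < 2*n" "active x"
    have f: "flow x (?V z) = (if z = x then 1 else 0) - (if lab z = Suc x then 1 else 0)" if "z < 2*n" for z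
      using FD(3)[OF that x] .
    show "flow x (Z' dm) = 0"
      unfolding Z'(2) using bc lab by (auto simp: f)
  qed
  moreover have "lkp (Z' dm) [a, b, c, d] = 1"
  proof -
    have "[a, b, c, d] \<notin> Poly_Mapping.keys (?V x)" for x
      using kT[of x] subset_trans[OF image_mono[OF TQ] R(3)] R(2) by blast
    then show ?thesis unfolding Z'(2) by (auto simp: lookup_add lookup_minus lookup_el in_keys_iff)
  qed
  moreover have "lkp (Z' dm) (piv t) = 0" "lkp (Z t) [a, b, c, d] = 0" "piv t \<noteq> [a, b, c, d]" if t: "t < dm" for t
  proof -
    have "piv t \<in> R" "Poly_Mapping.keys (Z t) \<subseteq> R" using R(1) t unfolding pivoted_def by auto
    then show "lkp (Z t) [a, b, c, d] = 0" "piv t \<noteq> [a, b, c, d]"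
      using R(2) by (auto simp: in_keys_iff)
    have "piv t \<notin> Poly_Mapping.keys (Z' dm)"
    proof
      assume "piv t \<in> Poly_Mapping.keys (Z' dm)"
      then have "piv t = [a, b, c, d] \<or> (\<exists>j<nt. piv t = [a, tb j, tc j, d])" using kz by auto
      then show False using tree[OF _ t] \<open>piv t \<noteq> [a, b, c, d]\<close> by blast
    qed
    then show "lkp (Z' dm) (piv t) = 0" by (simp add: in_keys_iff)
  qed
  moreover have "Poly_Mapping.keys (Z' dm) \<subseteq> insert [a, b, c, d] R"
    using kz subset_trans[OF image_mono[OF TQ] R(3)] by blast
  ultimately show ?thesis
    using R(1) unfolding pivoted_def by (auto simp: less_Suc_eq Z'(1))
qed

text \<open>All that is kept of a finished forest: potentials fit for
  \<open>Omega3_in_span_potential\<close>. Unlike the arrays, this survives the treatment of further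
  pairs, being monotone in \<open>W\<close>.\<close>

definition settled :: "(nat list \<Rightarrow>\<^sub>0 'k::field) set \<Rightarrow> bool" where
  "settled W \<longleftrightarrow> (\<exists>V. (\<forall>x<2*n. \<not> active x \<longrightarrow> V x = 0) \<and>
    (\<forall>b c. edge b c \<longrightarrow> el [a, b, c, d] - V b + V (n + c) \<in> pv.span W))"

lemma forest_settled:
  assumes "forest Q W nt lab P tb tc" "\<And>b c. edge b c \<Longrightarrow> (b, c) \<in> Q"
  shows "settled W"
  unfolding settled_def using forestD(1,4)[OF assms(1)] assms(2) by blast

lemma settled_mono: "settled W \<Longrightarrow> pv.span W \<subseteq> pv.span W' \<Longrightarrow> settled W'"
  unfolding settled_def by (meson subsetD)

end

lemma settled_pivoted_basis:
  fixes Z :: "nat \<Rightarrow> (nat list \<Rightarrow>\<^sub>0 'k::field)"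
  assumes H: "pair_loopfree_digraph H" and verts: "pverts H = {..<n}"
    and R: "pivoted H R dm Z piv"
    and settled: "\<And>a d. a < n \<Longrightarrow> d < n \<Longrightarrow> end_pair.settled H n a d (Z ` {..<dm})"
  shows "is_basis (Z ` {..<dm}) (Omega 3 H)" "inj_on Z {..<dm}" "pv.dim (Omega 3 H :: (nat list \<Rightarrow>\<^sub>0 'k) set) = dm"
proof -
  interpret pair_loopfree_digraph H by (rule H)
  let ?W = "Z ` {..<dm}"
  have ep: "end_pair H n" using H verts by (simp add: end_pair_def)
  note pi = pivoted_independent[OF R]
  have "pv.span ?W = Omega 3 H"
  proof
    show "pv.span ?W \<subseteq> Omega 3 H"
      using R by (intro pv.span_minimal subspace_Omega3[OF H]) (auto simp: pivoted_def)
    have "\<exists>V. (\<forall>x<2*n. \<not> end_pair.active H n a d x \<longrightarrow> V x = 0) \<and>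
        (\<forall>b c. end_pair.edge H a d b c \<longrightarrow> el [a, b, c, d] - V b + V (n + c) \<in> pv.span ?W)"
      if "a < n" "d < n" for a d
      using settled[OF that] unfolding end_pair.settled_def[OF ep] .
    then obtain V :: "nat \<Rightarrow> nat \<Rightarrow> nat \<Rightarrow> (nat list \<Rightarrow>\<^sub>0 'k)" where
      V0: "\<And>a d x. a < n \<Longrightarrow> d < n \<Longrightarrow> x < 2*n \<Longrightarrow> \<not> end_pair.active H n a d x \<Longrightarrow> V a d x = 0" and
      V1: "\<And>a d b c. a < n \<Longrightarrow> d < n \<Longrightarrow> end_pair.edge H a d b c \<Longrightarrow>
        el [a, b, c, d] - V a d b + V a d (n + c) \<in> pv.span ?W"
      by metis
    show "Omega 3 H \<subseteq> pv.span ?W"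
    proof
      fix u :: "nat list \<Rightarrow>\<^sub>0 'k" assume "u \<in> Omega 3 H"
      \<comment> \<open>Here vectors run towards the root, hence the minus signs. Outside the vertex
        set, where \<open>settled\<close> says nothing, the default is 0.\<close>
      then show "u \<in> pv.span ?W"
      proof (rule Omega3_in_span_potential[OF H, where
          P = "\<lambda>a b d. if a < n \<and> b < n \<and> d < n then - V a d b else 0" and
          Q = "\<lambda>a c d. if a < n \<and> c < n \<and> d < n then - V a d (n + c) else 0"])
        fix a b d assume "b = d \<or> (b, d) \<in> parcs H"
        then show "(if a < n \<and> b < n \<and> d < n then - V a d b else 0) = 0"
          using V0[of a d b] by (auto simp: end_pair.active_def[OF ep])
      next
        fix a c d assume "a = c \<or> (a, c) \<in> parcs H"
        then show "(if a < n \<and> c < n \<and> d < n then - V a d (n + c) else 0) = 0"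
          using V0[of a d "n + c"] by (auto simp: end_pair.active_def[OF ep])
      next
        fix a b c d assume al: "[a, b, c, d] \<in> allowed_paths 3 H"
        then have "a < n" "b < n" "c < n" "d < n"
          using verts by (auto simp: allowed_paths_def)
        then show "el [a, b, c, d] + (if a < n \<and> b < n \<and> d < n then - V a d b else 0)
            - (if a < n \<and> c < n \<and> d < n then - V a d (n + c) else 0) \<in> pv.span ?W"
          using V1[of a d b c] al by (simp add: end_pair.edge_allowed[OF ep, symmetric])
      qed
    qed
  qed
  then show "is_basis ?W (Omega 3 H)" using pi(2) by (simp add: is_basis_def)
  show "inj_on Z {..<dm}" by (rule pi(1))
  have "pv.dim (Omega 3 H :: (nat list \<Rightarrow>\<^sub>0 'k) set) = card ?W"
    using \<open>pv.span ?W = Omega 3 H\<close> pi(2) by (metis pv.dim_eq_card pv.span_span)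
  then show "pv.dim (Omega 3 H :: (nat list \<Rightarrow>\<^sub>0 'k) set) = dm"
    by (simp add: card_image[OF pi(1)])
qed

section \<open>Reasoning about programs and their running time\<close>

definition wp :: "com \<Rightarrow> (('k::field) store \<Rightarrow> nat \<Rightarrow> bool) \<Rightarrow> 'k store \<Rightarrow> bool" where
  "wp c Q s \<longleftrightarrow> (\<exists>t s'. exec c s t s' \<and> Q s' t)"

lemma wp_mono: "wp c Q s \<Longrightarrow> (\<And>s' t. Q s' t \<Longrightarrow> R s' t) \<Longrightarrow> wp c R s"
  unfolding wp_def by blast

lemma wp_Skip: "Q s 1 \<Longrightarrow> wp Skip Q s"
  unfolding wp_def by (blast intro: exec.Skip)

lemma wp_NSet:
  "Q (nset a (map (nval s) is) (nval s x) s) (Suc (sum_list (map ncost is) + ncost x)) \<Longrightarrow> wp (NSet a is x) Q s"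
  unfolding wp_def by (blast intro: exec.NSet)

lemma wp_KSet:
  "Q (kset a (map (nval s) is) (kval s x) s) (Suc (sum_list (map ncost is) + kcost x)) \<Longrightarrow> wp (KSet a is x) Q s"
  unfolding wp_def by (blast intro: exec.KSet)

lemma wp_Seq:
  "wp c1 (\<lambda>s1 t1. wp c2 (\<lambda>s2 t2. Q s2 (t1 + t2)) s1) s \<Longrightarrow> wp (Seq c1 c2) Q s"
  unfolding wp_def by (blast intro: exec.Seq)

lemma wp_Cond:
  assumes "bval s b \<Longrightarrow> wp c1 (\<lambda>s' t. Q s' (Suc (bcost b + t))) s"
    and "\<not> bval s b \<Longrightarrow> wp c2 (\<lambda>s' t. Q s' (Suc (bcost b + t))) s"
  shows "wp (Cond b c1 c2) Q s"
  using assms unfolding wp_def by (cases "bval s b") (blast intro: exec.CondTrue exec.CondFalse)+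

section \<open>Frames: the arrays a program leaves alone\<close>

fun nmod :: "com \<Rightarrow> string set" where
  "nmod Skip = {}"
| "nmod (NSet a is x) = {a}"
| "nmod (KSet a is x) = {}"
| "nmod (Seq c1 c2) = nmod c1 \<union> nmod c2"
| "nmod (Cond b c1 c2) = nmod c1 \<union> nmod c2"
| "nmod (While b c) = nmod c"

fun kmod :: "com \<Rightarrow> string set" where
  "kmod Skip = {}"
| "kmod (NSet a is x) = {}"
| "kmod (KSet a is x) = {a}"
| "kmod (Seq c1 c2) = kmod c1 \<union> kmod c2"
| "kmod (Cond b c1 c2) = kmod c1 \<union> kmod c2"
| "kmod (While b c) = kmod c"

definition frame :: "string set \<Rightarrow> string set \<Rightarrow> 'k store \<Rightarrow> 'k store \<Rightarrow> bool" where
  "frame N K s s' \<longleftrightarrow> (\<forall>a. a \<notin> N \<longrightarrow> ncell s' a = ncell s a) \<and> (\<forall>a. a \<notin> K \<longrightarrow> kcell s' a = kcell s a)"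

lemma frame_refl: "frame N K s s"
  by (simp add: frame_def)

lemma frame_trans: "frame N K s s' \<Longrightarrow> frame N K s' s'' \<Longrightarrow> frame N K s s''"
  by (simp add: frame_def)

lemma frame_mono: "frame N K s s' \<Longrightarrow> N \<subseteq> N' \<Longrightarrow> K \<subseteq> K' \<Longrightarrow> frame N' K' s s'"
  by (auto simp: frame_def)

lemma frame_ncell: "frame N K s s' \<Longrightarrow> a \<notin> N \<Longrightarrow> ncell s' a = ncell s a"
  by (simp add: frame_def)

lemma frame_kcell: "frame N K s s' \<Longrightarrow> a \<notin> K \<Longrightarrow> kcell s' a = kcell s a"
  by (simp add: frame_def)

lemma ncell_nset [simp]: "ncell (nset a js c s) = (ncell s)(a := (ncell s a)(js := c))"
  and kcell_nset [simp]: "kcell (nset a js c s) = kcell s"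
  and ncell_kset [simp]: "ncell (kset a js k s) = ncell s"
  and kcell_kset [simp]: "kcell (kset a js k s) = (kcell s)(a := (kcell s a)(js := k))"
  by (simp_all add: nset_def kset_def)

lemma exec_frame: "exec c s t s' \<Longrightarrow> frame (nmod c) (kmod c) s s'"
  by (induction rule: exec.induct) (auto simp: frame_def)

definition For :: "string \<Rightarrow> nexp \<Rightarrow> com \<Rightarrow> com" where
  "For i ub c = Seq (NSet i [] (NLit 0))
     (While (NLess (NGet i []) ub) (Seq c (NSet i [] (NSucc (NGet i [])))))"

lemma nmod_For [simp]: "nmod (For i ub c) = insert i (nmod c)"
  and kmod_For [simp]: "kmod (For i ub c) = kmod c"
  by (auto simp: For_def)

text \<open>The invariant speaks about the running time so far, which allows for amortized analysis.\<close>

lemma wp_For: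
  assumes i: "i \<notin> nmod c"
    and ub: "\<And>s. frame (insert i (nmod c)) (kmod c) s0 s \<Longrightarrow> nval s ub = N"
    and init: "I 0 (nset i [] 0 s0) 0"
    and step: "\<And>k s t. k < N \<Longrightarrow> frame (insert i (nmod c)) (kmod c) s0 s \<Longrightarrow> ncell s i [] = k \<Longrightarrow> I k s t \<Longrightarrow>
      wp c (\<lambda>s' t'. frame (insert i (nmod c)) (kmod c) s0 s' \<longrightarrow> ncell s' i [] = k \<longrightarrow> I (Suc k) (nset i [] (Suc k) s') (t + t' + (ncost ub + 6))) s"
    and final: "\<And>s t. frame (insert i (nmod c)) (kmod c) s0 s \<Longrightarrow> I N s t \<Longrightarrow> Q s (t + (ncost ub + 5))"
  shows "wp (For i ub c) Q s0"
proof -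
  let ?b = "NLess (NGet i []) ub" and ?c = "Seq c (NSet i [] (NSucc (NGet i [])))"
  let ?F = "frame (insert i (nmod c)) (kmod c)"
  \<comment> \<open>Besides the body, a pass costs \<open>ncost ub + 3\<close> for the test and 3
    for the increment. The failing test costs \<open>ncost ub + 3\<close> again and the
    initialisation 2, whence the constants 6 and 5.\<close>
  have loop: "\<exists>t' s'. exec (While ?b ?c) s t' s' \<and> ?F s0 s' \<and>
      (\<exists>u. I N s' u \<and> t + t' = u + (ncost ub + 3))"
    if "k \<le> N" "?F s0 s" "ncell s i [] = k" "I k s t" for k s t
    using that
  proof (induction "N - k" arbitrary: k s t)
    case 0
    then have "\<not> bval s ?b" using ub[OF 0(3)] by simp
    then have "exec (While ?b ?c) s (Suc (bcost ?b)) s" by (rule exec.WhileFalse)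
    then show ?case using 0 by (intro exI[of _ "Suc (bcost ?b)"] exI[of _ s]) auto
  next
    case (Suc d)
    then have k: "k < N" by simp
    obtain t1 s1 where e: "exec c s t1 s1" and
      I: "?F s0 s1 \<longrightarrow> ncell s1 i [] = k \<longrightarrow> I (Suc k) (nset i [] (Suc k) s1) (t + t1 + (ncost ub + 6))"
      using step[OF k Suc.prems(2-4)] unfolding wp_def by blast
    have f: "frame (nmod c) (kmod c) s s1" using exec_frame[OF e] .
    have F1: "?F s0 s1" using frame_trans[OF Suc.prems(2)] frame_mono[OF f] by blast
    have i1: "ncell s1 i [] = k" using frame_ncell[OF f i] Suc.prems(3) by simp
    let ?s2 = "nset i [] (Suc k) s1"
    have F2: "?F s0 ?s2" using F1 by (auto simp: frame_def)
    have "exec (NSet i [] (NSucc (NGet i []))) s1 3 ?s2"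
      using exec.NSet[of i "[]" "NSucc (NGet i [])" s1] i1 by (simp add: numeral_3_eq_3)
    then have e2: "exec ?c s (t1 + 3) ?s2" by (rule exec.Seq[OF e])
    obtain t' s' u where w: "exec (While ?b ?c) ?s2 t' s'" "?F s0 s'" "I N s' u"
      "(t + t1 + (ncost ub + 6)) + t' = u + (ncost ub + 3)"
    proof -
      have "d = N - Suc k" "Suc k \<le> N" "ncell ?s2 i [] = Suc k" using Suc.hyps(2) k by auto
      moreover have "I (Suc k) ?s2 (t + t1 + (ncost ub + 6))" using I F1 i1 by blast
      ultimately show ?thesis using Suc.hyps(1)[OF _ _ F2] that by blast
    qed
    have "bval s ?b" using ub[OF Suc.prems(2)] Suc.prems(3) k by simp
    from exec.WhileTrue[OF this e2 w(1)]
    have "exec (While ?b ?c) s (Suc (bcost ?b + (t1 + 3) + t')) s'" .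
    then show ?case using w by (intro exI[of _ "Suc (bcost ?b + (t1 + 3) + t')"] exI[of _ s']) auto
  qed
  let ?s1 = "nset i [] 0 s0"
  have F1: "?F s0 ?s1" by (auto simp: frame_def)
  obtain t' s' u where w: "exec (While ?b ?c) ?s1 t' s'" "?F s0 s'" "I N s' u" "0 + t' = u + (ncost ub + 3)"
    using loop[of 0 ?s1 0, OF _ F1 _ init] by auto
  have "exec (NSet i [] (NLit 0)) s0 2 ?s1"
    using exec.NSet[of i "[]" "NLit 0" s0] by (simp add: numeral_2_eq_2)
  from exec.Seq[OF this w(1)] have "exec (For i ub c) s0 (2 + t') s'"
    unfolding For_def .
  moreover have "2 + t' = u + (ncost ub + 5)" using w(4) by simp
  then have "Q s' (2 + t')" using final[OF w(2,3)] by (simp only:)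
  ultimately show ?thesis unfolding wp_def by blast
qed

section \<open>The program\<close>

abbreviation (input) seq (infixr ";;" 60) where "c1 ;; c2 \<equiv> Seq c1 c2"

abbreviation (input) var :: "string \<Rightarrow> nexp" where "var a \<equiv> NGet a []"

text \<open>The machine has no addition. The sums \<open>n + v\<close>, the numbers of the
  third-position nodes, are tabulated in \<open>off\<close> by counting on from \<open>n\<close>;
  the counter \<open>m\<close> ends at \<open>2 * n\<close>.\<close>

definition setup_c :: com where
  "setup_c = NSet ''m'' [] (var ''n'') ;;
     For ''v'' (var ''n'') (NSet ''off'' [var ''v''] (var ''m'') ;; NSet ''m'' [] (NSucc (var ''m'')))"

definition label_body :: com where
  "label_body =
     Cond (BAnd (NEq (NGet ''adj'' [var ''v'', var ''d'']) (NLit 0)) (BNot (NEq (var ''v'') (var ''d''))))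
       (NSet ''lab'' [var ''v''] (NSucc (var ''v''))) (NSet ''lab'' [var ''v''] (NLit 0)) ;;
     Cond (BAnd (NEq (NGet ''adj'' [var ''a'', var ''v'']) (NLit 0)) (BNot (NEq (var ''v'') (var ''a''))))
       (NSet ''lab'' [NGet ''off'' [var ''v'']] (NSucc (NGet ''off'' [var ''v''])))
       (NSet ''lab'' [NGet ''off'' [var ''v'']] (NLit 0))"

definition label_c :: com where
  "label_c = For ''v'' (var ''n'') label_body ;; NSet ''nt'' [] (NLit 0)"

text \<open>Tree edges common to both paths to the root drop out of the cycle; skipping them keeps
  all listed coefficients nonzero.\<close>

definition emit_body :: com where
  "emit_body =
     Cond (KEq (KGet ''P'' [NGet ''off'' [var ''c''], var ''j'']) (KGet ''P'' [var ''b'', var ''j''])) Skip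
      (KSet ''coef'' [var ''dim'', var ''r'']
         (KSub (KGet ''P'' [NGet ''off'' [var ''c''], var ''j'']) (KGet ''P'' [var ''b'', var ''j''])) ;;
       NSet ''vert'' [var ''dim'', var ''r'', NLit 0] (var ''a'') ;;
       NSet ''vert'' [var ''dim'', var ''r'', NLit 1] (NGet ''tb'' [var ''j'']) ;;
       NSet ''vert'' [var ''dim'', var ''r'', NLit 2] (NGet ''tc'' [var ''j'']) ;;
       NSet ''vert'' [var ''dim'', var ''r'', NLit 3] (var ''d'') ;;
       NSet ''r'' [] (NSucc (var ''r'')))"

definition emit_c :: com where
  "emit_c =
     KSet ''coef'' [var ''dim'', NLit 0] KOne ;;
     NSet ''vert'' [var ''dim'', NLit 0, NLit 0] (var ''a'') ;;
     NSet ''vert'' [var ''dim'', NLit 0, NLit 1] (var ''b'') ;;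
     NSet ''vert'' [var ''dim'', NLit 0, NLit 2] (var ''c'') ;;
     NSet ''vert'' [var ''dim'', NLit 0, NLit 3] (var ''d'') ;;
     NSet ''r'' [] (NLit 1) ;;
     For ''j'' (var ''nt'') emit_body ;;
     NSet ''len'' [var ''dim''] (var ''r'') ;;
     NSet ''dim'' [] (NSucc (var ''dim''))"

text \<open>Column \<open>nt\<close> is cleared for every row first, as it may hold entries from an
  earlier pair of end vertices.\<close>

definition shift_body :: com where
  "shift_body =
     KSet ''P'' [var ''x'', var ''nt''] KZero ;;
     Cond (NEq (NGet ''lab'' [var ''x'']) (var ''old''))
       (For ''j'' (NSucc (var ''nt''))
          (KSet ''P'' [var ''x'', var ''j''] (KAdd (KGet ''P'' [var ''x'', var ''j'']) (KGet ''dl'' [var ''j'']))) ;;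
        NSet ''lab'' [var ''x''] (var ''new''))
       Skip"

text \<open>The branch makes \<open>q\<close> a node with nonzero label; as the two labels differ,
  there is one. The shift is copied to \<open>dl\<close> because row \<open>q\<close> itself changes
  in the loop over \<open>x\<close>.\<close>

definition merge_c :: com where
  "merge_c =
     Cond (NEq (NGet ''lab'' [NGet ''off'' [var ''c'']]) (NLit 0))
       (NSet ''p'' [] (NGet ''off'' [var ''c'']) ;; NSet ''q'' [] (var ''b'') ;; KSet ''sg'' [] (KSub KZero KOne))
       (NSet ''p'' [] (var ''b'') ;; NSet ''q'' [] (NGet ''off'' [var ''c'']) ;; KSet ''sg'' [] KOne) ;;
     NSet ''old'' [] (NGet ''lab'' [var ''q'']) ;;
     NSet ''new'' [] (NGet ''lab'' [var ''p'']) ;;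
     For ''j'' (var ''nt'')
       (KSet ''dl'' [var ''j''] (KSub (KGet ''P'' [var ''p'', var ''j'']) (KGet ''P'' [var ''q'', var ''j'']))) ;;
     KSet ''dl'' [var ''nt''] (KSub KZero (KGet ''sg'' [])) ;;
     For ''x'' (var ''m'') shift_body ;;
     NSet ''tb'' [var ''nt''] (var ''b'') ;;
     NSet ''tc'' [var ''nt''] (var ''c'') ;;
     NSet ''nt'' [] (NSucc (var ''nt''))"

definition edge_c :: com where
  "edge_c =
     Cond (BAnd (NEq (NGet ''adj'' [var ''a'', var ''b'']) (NLit 1))
            (BAnd (NEq (NGet ''adj'' [var ''b'', var ''c'']) (NLit 1)) (NEq (NGet ''adj'' [var ''c'', var ''d'']) (NLit 1))))
       (Cond (NEq (NGet ''lab'' [var ''b'']) (NGet ''lab'' [NGet ''off'' [var ''c'']])) emit_c merge_c)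
       Skip"

definition pair_c :: com where
  "pair_c = label_c ;; For ''b'' (var ''n'') (For ''c'' (var ''n'') edge_c)"

definition Omega3_c :: com where
  "Omega3_c = setup_c ;; For ''a'' (var ''n'') (For ''d'' (var ''n'') pair_c)"

lemma nmod_parts [simp]:
  "nmod setup_c = {''m'', ''off'', ''v''}"
  "nmod label_body = {''lab''}" "nmod label_c = {''v'', ''lab'', ''nt''}"
  "nmod emit_body = {''vert'', ''r''}" "nmod emit_c = {''vert'', ''r'', ''j'', ''len'', ''dim''}"
  "nmod shift_body = {''j'', ''lab''}"
  "nmod merge_c = {''p'', ''q'', ''old'', ''new'', ''j'', ''x'', ''lab'', ''tb'', ''tc'', ''nt''}"
  "nmod edge_c = {''vert'', ''r'', ''j'', ''len'', ''dim'', ''p'', ''q'', ''old'', ''new'', ''x'', ''lab'', ''tb'', ''tc'', ''nt''}"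
  by (auto simp: setup_c_def label_body_def label_c_def emit_body_def emit_c_def shift_body_def merge_c_def edge_c_def)

lemma kmod_parts [simp]:
  "kmod setup_c = {}" "kmod label_body = {}" "kmod label_c = {}"
  "kmod emit_body = {''coef''}" "kmod emit_c = {''coef''}"
  "kmod shift_body = {''P''}" "kmod merge_c = {''sg'', ''dl'', ''P''}" "kmod edge_c = {''coef'', ''sg'', ''dl'', ''P''}"
  by (auto simp: setup_c_def label_body_def label_c_def emit_body_def emit_c_def shift_body_def merge_c_def edge_c_def)

section \<open>Correctness and running time of the parts of the program\<close>

definition static :: "nat pair_pre_digraph \<Rightarrow> nat \<Rightarrow> 'k store \<Rightarrow> bool" where
  "static H n s \<longleftrightarrow> ncell s ''n'' [] = n \<and> ncell s ''m'' [] = 2 * n \<and> (\<forall>i<n. ncell s ''off'' [i] = n + i) \<and>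
     (\<forall>u v. ncell s ''adj'' [u, v] = (if (u, v) \<in> parcs H then 1 else 0))"

lemma static_frame:
  assumes "frame N K s s'" "N \<inter> {''n'', ''m'', ''off'', ''adj''} = {}"
  shows "static H n s' = static H n s"
proof -
  have "ncell s' a = ncell s a" if "a \<in> {''n'', ''m'', ''off'', ''adj''}" for a
    using assms that by (intro frame_ncell[OF assms(1)]) blast
  then show ?thesis by (simp add: static_def)
qed

lemma wp_setup:
  fixes s :: "'k::field store"
  assumes s: "ncell s ''n'' [] = n"
    "\<And>u v. ncell s ''adj'' [u, v] = (if (u, v) \<in> parcs H then 1 else 0)"
    and Q: "\<And>s' t. frame {''m'', ''off'', ''v''} {} s s' \<Longrightarrow> static H n s' \<Longrightarrow> t \<le> 20 * n + 20 \<Longrightarrow> Q s' t"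
  shows "wp setup_c Q s"
  unfolding setup_c_def
proof (rule wp_Seq, rule wp_NSet, simp, rule wp_For[where N = n and
    I = "\<lambda>k s t. ncell s ''m'' [] = n + k \<and> (\<forall>i<k. ncell s ''off'' [i] = n + i) \<and> t \<le> 20 * k"], goal_cases)
  case (2 s')
  then show ?case using s by (simp add: frame_def)
next
  case (4 k s' t)
  then show ?case
    by (intro wp_Seq wp_NSet) (auto simp: less_Suc_eq)
next
  case (5 s' t)
  show ?case
    apply (rule Q)
    using 5 s by (auto simp: frame_def static_def)
qed (use s in auto)

lemma wp_label:
  fixes s :: "'k::field store"
  assumes ep: "end_pair H n" and s: "static H n s" and a: "ncell s ''a'' [] = a" and d: "ncell s ''d'' [] = d"
    and Q: "\<And>s' t. frame {''v'', ''lab'', ''nt''} {} s s' \<Longrightarrow>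
      (\<And>x. x < 2 * n \<Longrightarrow> ncell s' ''lab'' [x] = (if end_pair.active H n a d x then Suc x else 0)) \<Longrightarrow>
      ncell s' ''nt'' [] = 0 \<Longrightarrow> t \<le> 60 * n + 20 \<Longrightarrow> Q s' t"
  shows "wp label_c Q s"
  unfolding label_c_def
proof (rule wp_Seq, rule wp_For[where N = n and
    I = "\<lambda>k s t. (\<forall>v<k. ncell s ''lab'' [v] = (if end_pair.active H n a d v then Suc v else 0)
       \<and> ncell s ''lab'' [n + v] = (if end_pair.active H n a d (n + v) then Suc (n + v) else 0)) \<and> t \<le> 60 * k"], goal_cases)
  case (2 s')
  then show ?case using s by (simp add: frame_def static_def)
next
  case (4 k s' t)
  have fr: "\<And>x. x \<notin> {''v'', ''lab''} \<Longrightarrow> ncell s' x = ncell s x"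
    using 4(2) by (simp add: frame_def)
  show ?case
    unfolding label_body_def
    apply (rule wp_Seq)
    apply (rule wp_Cond; rule wp_NSet; rule wp_Cond; rule wp_NSet)
    using 4 s a d
       by (auto simp: fr static_def end_pair.active_def[OF ep] less_Suc_eq split: if_splits)
next
  case (5 s' t)
  show ?case
  proof (rule wp_NSet, rule Q, goal_cases)
    case (2 x)
    then show ?case using 5(2) by (cases "x < n") (auto simp: le_iff_add not_less)
  qed (use 5 in \<open>auto simp: frame_def\<close>)
qed simp_all

section \<open>Output of a fundamental cycle\<close>

lemma out_path_4:
  "out_path s t r = [ncell s ''vert'' [t, r, 0], ncell s ''vert'' [t, r, 1], ncell s ''vert'' [t, r, 2], ncell s ''vert'' [t, r, 3]]"
  by (simp add: out_path_def upt_rec numeral_eq_Suc)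

lemma wp_emit_loop:
  fixes s :: "'k::field store"
  assumes s: "static H n s" and vars: "ncell s ''a'' [] = a" "ncell s ''b'' [] = b" "ncell s ''c'' [] = c" "ncell s ''d'' [] = d"
      "ncell s ''nt'' [] = nt" "ncell s ''dim'' [] = dm" "ncell s ''r'' [] = 1" and c: "c < n"
    and first: "out_path s dm 0 = [a, b, c, d]" "out_coef s dm 0 = 1"
    and T: "\<And>j. T j = [a, ncell s ''tb'' [j], ncell s ''tc'' [j], d]" "inj_on T {..<nt}" "[a, b, c, d] \<notin> T ` {..<nt}"
    and D: "\<And>j. D j = kcell s ''P'' [n + c, j] - kcell s ''P'' [b, j]"
    and Q: "\<And>s' t. frame {''vert'', ''r'', ''j''} {''coef''} s s' \<Longrightarrow>
      (\<Sum>i<ncell s' ''r'' []. scl (out_coef s' dm i) (el (out_path s' dm i))) = el [a, b, c, d] + (\<Sum>j<nt. scl (D j) (el (T j))) \<Longrightarrow>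
      inj_on (out_path s' dm) {..<ncell s' ''r'' []} \<Longrightarrow>
      (\<And>i. i < ncell s' ''r'' [] \<Longrightarrow> out_coef s' dm i \<noteq> 0) \<Longrightarrow>
      (\<And>u i. u \<noteq> dm \<Longrightarrow> out_coef s' u i = out_coef s u i \<and> out_path s' u i = out_path s u i) \<Longrightarrow>
      t \<le> 80 * nt + 10 \<Longrightarrow> Q s' t"
  shows "wp (For ''j'' (var ''nt'') emit_body) Q s"
proof -
  \<comment> \<open>The clause on the image shows that \<open>T k\<close> has not been listed yet,
    so that injectivity persists.\<close>
  define I where "I k s' t \<longleftrightarrow> (let r = ncell s' ''r'' [] in
      (\<Sum>i<r. scl (out_coef s' dm i) (el (out_path s' dm i))) = el [a, b, c, d] + (\<Sum>j<k. scl (D j) (el (T j))) \<and>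
      inj_on (out_path s' dm) {..<r} \<and> out_path s' dm ` {..<r} \<subseteq> insert [a, b, c, d] (T ` {..<k}) \<and>
      (\<forall>i<r. out_coef s' dm i \<noteq> 0) \<and>
      (\<forall>u i. u \<noteq> dm \<longrightarrow> out_coef s' u i = out_coef s u i \<and> out_path s' u i = out_path s u i) \<and> t \<le> 80 * k)"
    for k :: nat and s' :: "'k store" and t :: nat
  have Imono: "I k s t \<Longrightarrow> t' \<le> t \<Longrightarrow> I k s t'" for k s t t'
    by (auto simp: I_def Let_def)
  have jset: "out_coef (nset ''j'' [] x s') = out_coef s'" "out_path (nset ''j'' [] x s') = out_path s'" for x and s' :: "'k store"
    by (auto simp: out_coef_def out_path_def fun_eq_iff)
  show ?thesis
  proof (rule wp_For[where N = nt and I = I], goal_cases)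
    case 1
    then show ?case by simp
  next
    case (2 s')
    then show ?case using vars by (simp add: frame_def)
  next
    case 3
    then show ?case using vars first by (auto simp: I_def jset lessThan_Suc)
  next
    case (4 k s' t)
    have fr: "\<And>x. x \<notin> {''vert'', ''r'', ''j''} \<Longrightarrow> ncell s' x = ncell s x" "\<And>x. x \<notin> {''coef''} \<Longrightarrow> kcell s' x = kcell s x"
      using 4(2) by (auto simp: frame_def)
    have off: "ncell s ''off'' [c] = n + c" using s c by (simp add: static_def)
    define r where "r = ncell s' ''r'' []"
    have I: "(\<Sum>i<r. scl (out_coef s' dm i) (el (out_path s' dm i))) = el [a, b, c, d] + (\<Sum>j<k. scl (D j) (el (T j)))"
      "inj_on (out_path s' dm) {..<r}" "out_path s' dm ` {..<r} \<subseteq> insert [a, b, c, d] (T ` {..<k})"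
      "\<And>i. i < r \<Longrightarrow> out_coef s' dm i \<noteq> 0"
      "\<And>u i. u \<noteq> dm \<Longrightarrow> out_coef s' u i = out_coef s u i \<and> out_path s' u i = out_path s u i" "t \<le> 80 * k"
      using 4(4) unfolding I_def r_def Let_def by blast+
    have Tk: "T k \<notin> insert [a, b, c, d] (T ` {..<k})"
    proof -
      have "T k \<noteq> [a, b, c, d]" using T(3) 4(1) by (metis imageI lessThan_iff)
      moreover have "T k \<noteq> T x" if "x < k" for x
        using inj_onD[OF T(2), of k x] that 4(1) by auto
      ultimately show ?thesis by auto
    qed
    show ?case
      unfolding emit_body_def
    proof (rule wp_Cond, goal_cases)
      case 1
      then have "D k = 0" using 4(3) vars off by (simp add: fr D)
      then have "I (Suc k) (nset ''j'' [] (Suc k) s') (t + 80)"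
        using I unfolding I_def by (auto simp: jset r_def[symmetric])
      then show ?case by (intro wp_Skip impI) (rule Imono, assumption, simp)
    next
      case 2
      then have Dk: "D k \<noteq> 0" using 4(3) vars off by (simp add: fr D)
      show ?case
      proof (intro wp_Seq wp_NSet wp_KSet impI, goal_cases)
        case 1
        define s2 where "s2 = nset ''r'' [] (Suc r)
          (nset ''vert'' [dm, r, 3] d (nset ''vert'' [dm, r, 2] (ncell s ''tc'' [k]) (nset ''vert'' [dm, r, 1] (ncell s ''tb'' [k])
          (nset ''vert'' [dm, r, 0] a (kset ''coef'' [dm, r] (D k) s')))))"
        have p: "out_path s2 u i = (if u = dm \<and> i = r then T k else out_path s' u i)"
          and cf: "out_coef s2 u i = (if u = dm \<and> i = r then D k else out_coef s' u i)" for u i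
          by (auto simp: s2_def out_path_4 out_coef_def T(1))
        have r2: "ncell s2 ''r'' [] = Suc r" by (simp add: s2_def)
        have "I (Suc k) (nset ''j'' [] (Suc k) s2) (t + 80)"
          unfolding I_def Let_def jset
        proof (intro conjI allI impI, goal_cases)
          case 1
          have "(\<Sum>i<r. scl (out_coef s2 dm i) (el (out_path s2 dm i))) = (\<Sum>i<r. scl (out_coef s' dm i) (el (out_path s' dm i)))"
            by (rule sum.cong) (auto simp: p cf)
          then show ?case using I(1) by (simp add: r2 p cf add.assoc)
        next
          case 2
          have "inj_on (out_path s2 dm) {..<r}"
            using I(2) by (subst inj_on_cong[of _ _ "out_path s' dm"]) (auto simp: p)
          moreover have "out_path s2 dm r \<notin> out_path s2 dm ` {..<r}"
            using I(3) Tk by (auto simp: p)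
          ultimately show ?case by (simp add: r2 lessThan_Suc)
        next
          case 3
          have "out_path s2 dm ` {..<r} = out_path s' dm ` {..<r}"
            by (rule image_cong) (auto simp: p)
          then show ?case using I(3) by (simp add: r2 p lessThan_Suc) blast
        next
          case (4 i)
          then show ?case using I(4) Dk by (auto simp: r2 cf less_Suc_eq)
        qed (use I(5,6) in \<open>auto simp: p cf\<close>)
        then have "I (Suc k) (nset ''j'' [] (Suc k) s2) t'" if "t' \<le> t + 80" for t'
          using that Imono by blast
        then show ?case using 4(3) vars off
          by (simp add: fr s2_def D r_def)
      qed
    qed
  next
    case (5 s' t)
    show ?case
      apply (rule Q)
      using 5 unfolding I_def Let_def by (auto simp: frame_def)
  qed
qed

lemma wp_emit:
  fixes s :: "'k::field store"
  assumes s: "static H n s" and vars: "ncell s ''a'' [] = a" "ncell s ''b'' [] = b" "ncell s ''c'' [] = c" "ncell s ''d'' [] = d"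
      "ncell s ''nt'' [] = nt" "ncell s ''dim'' [] = dm" and c: "c < n"
    and T: "\<And>j. T j = [a, ncell s ''tb'' [j], ncell s ''tc'' [j], d]" "inj_on T {..<nt}" "[a, b, c, d] \<notin> T ` {..<nt}"
    and D: "\<And>j. D j = kcell s ''P'' [n + c, j] - kcell s ''P'' [b, j]"
    and Q: "\<And>s' t. frame (nmod emit_c) (kmod emit_c) s s' \<Longrightarrow>
      out_elem s' dm = el [a, b, c, d] + (\<Sum>j<nt. scl (D j) (el (T j))) \<Longrightarrow>
      inj_on (out_path s' dm) {..<out_len s' dm} \<Longrightarrow>
      (\<And>i. i < out_len s' dm \<Longrightarrow> out_coef s' dm i \<noteq> 0) \<Longrightarrow>
      (\<And>u. u \<noteq> dm \<Longrightarrow> out_coef s' u = out_coef s u \<and> out_path s' u = out_path s u \<and> out_len s' u = out_len s u) \<Longrightarrow>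
      out_dim s' = Suc dm \<Longrightarrow> t \<le> 80 * nt + 70 \<Longrightarrow> Q s' t"
  shows "wp emit_c Q s"
proof -
  define s1 where "s1 = nset ''r'' [] 1
    (nset ''vert'' [dm, 0, 3] d (nset ''vert'' [dm, 0, 2] c (nset ''vert'' [dm, 0, 1] b
    (nset ''vert'' [dm, 0, 0] a (kset ''coef'' [dm, 0] 1 s)))))"
  have fr1: "frame {''vert'', ''r''} {''coef''} s s1"
    by (auto simp: s1_def frame_def)
  have fr1': "\<And>x. x \<notin> {''vert'', ''r''} \<Longrightarrow> ncell s1 x = ncell s x" "\<And>x. x \<notin> {''coef''} \<Longrightarrow> kcell s1 x = kcell s x"
    using fr1 by (auto simp: frame_def)
  have p1: "out_path s1 u i = (if u = dm \<and> i = 0 then [a, b, c, d] else out_path s u i)"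
    and c1: "out_coef s1 u i = (if u = dm \<and> i = 0 then 1 else out_coef s u i)" for u i
    by (auto simp: s1_def out_path_4 out_coef_def)
  have st1: "static H n s1" using s static_frame[OF fr1] by simp
  have r1: "ncell s1 ''r'' [] = 1" by (simp add: s1_def)
  have T1: "T j = [a, ncell s1 ''tb'' [j], ncell s1 ''tc'' [j], d]" for j using T(1) by (simp add: fr1')
  have D1: "D j = kcell s1 ''P'' [n + c, j] - kcell s1 ''P'' [b, j]" for j using D by (simp add: fr1')
  have v1: "ncell s1 ''a'' [] = a" "ncell s1 ''b'' [] = b" "ncell s1 ''c'' [] = c" "ncell s1 ''d'' [] = d"
      "ncell s1 ''nt'' [] = nt" "ncell s1 ''dim'' [] = dm"
    by (simp_all add: vars fr1')
  have f1: "out_path s1 dm 0 = [a, b, c, d]" "out_coef s1 dm 0 = 1"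
    by (simp_all add: p1 c1)
  show ?thesis
    unfolding emit_c_def
    apply (rule wp_Seq, rule wp_KSet, rule wp_Seq, rule wp_NSet, rule wp_Seq, rule wp_NSet, rule wp_Seq, rule wp_NSet,
      rule wp_Seq, rule wp_NSet, rule wp_Seq, rule wp_NSet, rule wp_Seq)
    apply (simp add: vars s1_def[symmetric] del: One_nat_def)
    apply (rule wp_emit_loop[OF st1 v1 r1 c f1 T1 T(2,3) D1])
  proof (intro wp_Seq wp_NSet Q, goal_cases)
    case (1 s2 t)
    then show ?case using fr1 by (auto simp: frame_def)
  next
    case (2 s2 t)
    have dm2: "ncell s2 ''dim'' [] = dm" using 2(1) vars by (simp add: frame_def fr1')
    show ?case using 2(2) by (simp add: out_elem_def out_len_def dm2 out_coef_def out_path_4)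
  next
    case (3 s2 t)
    have dm2: "ncell s2 ''dim'' [] = dm" using 3(1) vars by (simp add: frame_def fr1')
    show ?case using 3(3) by (simp add: out_len_def dm2 out_path_def inj_on_def)
  next
    case (4 s2 t i)
    have dm2: "ncell s2 ''dim'' [] = dm" using 4(1) vars by (simp add: frame_def fr1')
    show ?case using 4(4)[of i] 4(7) by (simp add: out_len_def dm2 out_coef_def)
  next
    case (5 s2 t u)
    have dm2: "ncell s2 ''dim'' [] = dm" using 5(1) vars by (simp add: frame_def fr1')
    have "ncell s2 ''len'' = ncell s ''len''" using 5(1) by (simp add: frame_def fr1')
    then show ?case using 5(5)[of u] 5(7)
      by (auto simp: out_len_def dm2 out_coef_def out_path_def fun_eq_iff s1_def)
  next
    case (6 s2 t)
    then show ?case using vars by (simp add: frame_def fr1' out_dim_def)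
  next
    case (7 s2 t)
    then show ?case by simp
  qed
qed

section \<open>Merging two components\<close>

lemma wp_shift:
  fixes s :: "'k::field store"
  assumes vars: "ncell s ''m'' [] = 2 * n" "ncell s ''nt'' [] = nt" "ncell s ''old'' [] = old" "ncell s ''new'' [] = new"
    and Q: "\<And>s' t. frame {''x'', ''j'', ''lab''} {''P''} s s' \<Longrightarrow>
      (\<And>x. x < 2 * n \<Longrightarrow> ncell s' ''lab'' [x] = (if ncell s ''lab'' [x] = old then new else ncell s ''lab'' [x])) \<Longrightarrow>
      (\<And>x j. x < 2 * n \<Longrightarrow> j < nt \<Longrightarrow> kcell s' ''P'' [x, j] = (if ncell s ''lab'' [x] = old
        then kcell s ''P'' [x, j] + kcell s ''dl'' [j] else kcell s ''P'' [x, j])) \<Longrightarrow>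
      (\<And>x. x < 2 * n \<Longrightarrow> kcell s' ''P'' [x, nt] = (if ncell s ''lab'' [x] = old then kcell s ''dl'' [nt] else 0)) \<Longrightarrow>
      t \<le> 2 * n * (20 * nt + 60) + 20 \<Longrightarrow> Q s' t"
  shows "wp (For ''x'' (var ''m'') shift_body) Q s"
\<comment> \<open>The clauses on labels and old columns also cover rows not yet reached: pass
  \<open>k\<close> has to find its label and its row unchanged.\<close>
proof (rule wp_For[where N = "2 * n" and I = "\<lambda>k s' t.
    (\<forall>x. ncell s' ''lab'' [x] = (if x < k \<and> ncell s ''lab'' [x] = old then new else ncell s ''lab'' [x])) \<and>
    (\<forall>x j. j < nt \<longrightarrow> kcell s' ''P'' [x, j] = (if x < k \<and> ncell s ''lab'' [x] = old
        then kcell s ''P'' [x, j] + kcell s ''dl'' [j] else kcell s ''P'' [x, j])) \<and>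
    (\<forall>x<k. kcell s' ''P'' [x, nt] = (if ncell s ''lab'' [x] = old then kcell s ''dl'' [nt] else 0)) \<and>
    t \<le> k * (20 * nt + 60)"], goal_cases)
  case (2 s')
  then show ?case using vars by (simp add: frame_def)
next
  case (4 k s' t)
  have fr: "\<And>x. x \<notin> {''x'', ''j'', ''lab''} \<Longrightarrow> ncell s' x = ncell s x" "\<And>x. x \<notin> {''P''} \<Longrightarrow> kcell s' x = kcell s x"
    using 4(2) by (auto simp: frame_def)
  note I = 4(4)
  let ?s1 = "kset ''P'' [k, nt] 0 s'"
  show ?case
    unfolding shift_body_def
  proof (rule wp_Seq, rule wp_KSet, simp add: 4(3) fr vars, rule wp_Cond, goal_cases)
    case 1
    then have old: "ncell s ''lab'' [k] = old" using I vars by (simp add: 4(3) fr)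
    show ?case
    proof (rule wp_Seq, rule wp_For[where N = "Suc nt" and I = "\<lambda>i s2 u.
        (\<forall>x j. kcell s2 ''P'' [x, j] = (if x = k \<and> j < i then kcell ?s1 ''P'' [x, j] + kcell s ''dl'' [j] else kcell ?s1 ''P'' [x, j])) \<and>
        u \<le> i * 20"], goal_cases)
      case (2 s2)
      then show ?case using vars by (simp add: frame_def fr)
    next
      case (4 i s2 u)
      then show ?case
        using vars \<open>ncell s' ''x'' [] = k\<close>
        by (intro wp_KSet) (auto simp: frame_def fr less_Suc_eq)
    next
      case (5 s2 u)
      have f2: "\<And>x. x \<notin> {''j''} \<Longrightarrow> ncell s2 x = ncell s' x" "ncell s2 ''x'' [] = k"
        using 5(1) 4(3) by (auto simp: frame_def)
      show ?case
        using I 5(2) old vars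
        by (intro wp_NSet) (auto simp: f2 fr less_Suc_eq algebra_simps)
    qed auto
  next
    case 2
    then have old: "ncell s ''lab'' [k] \<noteq> old" using I vars by (simp add: 4(3) fr)
    show ?case
      using I old by (intro wp_Skip) (auto simp: less_Suc_eq)
  qed
next
  case (5 s' t)
  show ?case
    apply (rule Q)
    using 5 by (auto simp: frame_def algebra_simps)
qed auto

text \<open>The postcondition has the form of the hypotheses of \<open>forest_merge\<close>, with
  \<open>p\<close>, \<open>q\<close> and \<open>sg\<close> left open because the labels decide the
  branch at run time.\<close>

lemma wp_merge:
  fixes s :: "'k::field store"
  assumes s: "static H n s" and vars: "ncell s ''b'' [] = b" "ncell s ''c'' [] = c" "ncell s ''nt'' [] = nt"
    and bc: "b < n" "c < n" and lab: "ncell s ''lab'' [b] \<noteq> ncell s ''lab'' [n + c]"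
    and Q: "\<And>s' t p q sg. frame (nmod merge_c) (kmod merge_c) s s' \<Longrightarrow>
      (p, q, sg) = (b, n + c, 1) \<or> (p, q, sg) = (n + c, b, - 1) \<Longrightarrow>
      ncell s ''lab'' [q] \<noteq> 0 \<Longrightarrow> ncell s ''lab'' [p] \<noteq> ncell s ''lab'' [q] \<Longrightarrow>
      (\<And>x. x < 2 * n \<Longrightarrow> ncell s' ''lab'' [x] = (if ncell s ''lab'' [x] = ncell s ''lab'' [q] then ncell s ''lab'' [p] else ncell s ''lab'' [x])) \<Longrightarrow>
      (\<And>x j. x < 2 * n \<Longrightarrow> j < nt \<Longrightarrow> kcell s' ''P'' [x, j] = (if ncell s ''lab'' [x] = ncell s ''lab'' [q]
        then kcell s ''P'' [x, j] + (kcell s ''P'' [p, j] - kcell s ''P'' [q, j]) else kcell s ''P'' [x, j])) \<Longrightarrow>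
      (\<And>x. x < 2 * n \<Longrightarrow> kcell s' ''P'' [x, nt] = (if ncell s ''lab'' [x] = ncell s ''lab'' [q] then - sg else 0)) \<Longrightarrow>
      (\<And>j. j < nt \<Longrightarrow> ncell s' ''tb'' [j] = ncell s ''tb'' [j] \<and> ncell s' ''tc'' [j] = ncell s ''tc'' [j]) \<Longrightarrow>
      ncell s' ''tb'' [nt] = b \<Longrightarrow> ncell s' ''tc'' [nt] = c \<Longrightarrow> ncell s' ''nt'' [] = Suc nt \<Longrightarrow>
      t \<le> 2 * n * (20 * nt + 60) + 40 * nt + 200 \<Longrightarrow> Q s' t"
  shows "wp merge_c Q s"
proof -
  \<comment> \<open>\<open>A\<close> below joins the two branches, so that the rest is verified
    once.\<close>
  let ?lab = "\<lambda>x. ncell s ''lab'' [x]" and ?P = "\<lambda>x j. kcell s ''P'' [x, j]"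
  have off: "ncell s ''off'' [c] = n + c" using s bc by (simp add: static_def)
  define A where "A s1 t1 \<longleftrightarrow> frame {''p'', ''q''} {''sg''} s s1 \<and> t1 \<le> 40 \<and>
    (\<exists>p q sg. ncell s1 ''p'' [] = p \<and> ncell s1 ''q'' [] = q \<and> kcell s1 ''sg'' [] = sg \<and>
      ((p, q, sg) = (b, n + c, 1) \<or> (p, q, sg) = (n + c, b, - 1)) \<and> ?lab q \<noteq> 0 \<and> ?lab p \<noteq> ?lab q)"
    for s1 :: "'k store" and t1 :: nat
  show ?thesis
    unfolding merge_c_def
  proof (rule wp_Seq, rule wp_mono[where Q = A], goal_cases)
    case 1
    show ?case
      apply (rule wp_Cond; intro wp_Seq wp_NSet wp_KSet)
      using lab bc by (auto simp: A_def vars off frame_def)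
  next
    case (2 s1 t1)
    then obtain p q sg where fr: "frame {''p'', ''q''} {''sg''} s s1" and t1: "t1 \<le> 40"
      and pq: "ncell s1 ''p'' [] = p" "ncell s1 ''q'' [] = q" "kcell s1 ''sg'' [] = sg"
      and c: "(p, q, sg) = (b, n + c, 1) \<or> (p, q, sg) = (n + c, b, - 1)" "?lab q \<noteq> 0" "?lab p \<noteq> ?lab q"
      unfolding A_def by blast
    have fr': "\<And>x. x \<notin> {''p'', ''q''} \<Longrightarrow> ncell s1 x = ncell s x" "\<And>x. x \<notin> {''sg''} \<Longrightarrow> kcell s1 x = kcell s x"
      using fr by (auto simp: frame_def)
    show ?case
    proof (rule wp_Seq, rule wp_NSet, rule wp_Seq, rule wp_NSet, rule wp_Seq, rule wp_For[where N = nt and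
        I = "\<lambda>k s2 u. (\<forall>j<k. kcell s2 ''dl'' [j] = ?P p j - ?P q j) \<and> u \<le> 20 * k"], goal_cases)
      case (2 s2)
      then show ?case by (simp add: frame_def fr' vars)
    next
      case (4 k s2 u)
      then show ?case
        by (intro wp_KSet) (auto simp: frame_def fr' pq less_Suc_eq)
    next
      case (5 s2 u)
      then have n2: "\<And>x. x \<notin> {''j'', ''p'', ''q'', ''old'', ''new''} \<Longrightarrow> ncell s2 x = ncell s x"
        and k2: "\<And>x. x \<notin> {''dl'', ''sg''} \<Longrightarrow> kcell s2 x = kcell s x"
        and v2: "ncell s2 ''old'' [] = ?lab q" "ncell s2 ''new'' [] = ?lab p" "kcell s2 ''sg'' [] = sg"
        and d2: "\<And>j. j < nt \<Longrightarrow> kcell s2 ''dl'' [j] = ?P p j - ?P q j" and u: "u \<le> 20 * nt"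
        by (auto simp: frame_def fr' pq)
      have v2': "ncell s2 ''m'' [] = 2 * n" "ncell s2 ''nt'' [] = nt" "ncell s2 ''b'' [] = b" "ncell s2 ''c'' [] = c"
        using s vars by (auto simp: n2 static_def)
      show ?case
      proof (rule wp_Seq, rule wp_KSet, rule wp_Seq, rule wp_shift[where n = n and nt = nt and old = "?lab q" and new = "?lab p"], goal_cases)
        case (5 s3 t3)
        then have n3: "\<And>x. x \<notin> {''x'', ''lab'', ''j'', ''p'', ''q'', ''old'', ''new''} \<Longrightarrow> ncell s3 x = ncell s x"
          and k3: "\<And>x. x \<notin> {''P'', ''dl'', ''sg''} \<Longrightarrow> kcell s3 x = kcell s x"
          by (auto simp: frame_def n2 k2)
        show ?case
        proof (intro wp_Seq wp_NSet, rule Q[OF _ c], goal_cases)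
          case 1
          show ?case by (simp add: frame_def n3 k3)
        next
          case (2 x)
          then show ?case using 5(2)[of x] by (simp add: n2)
        next
          case (3 x j)
          then show ?case using 5(3)[of x j] by (simp add: n2 k2 d2 vars)
        next
          case (4 x)
          then show ?case using 5(4)[of x] by (simp add: n2 v2 vars)
        next
          case (5 j)
          then show ?case by (simp add: n3 vars)
        next
          case 9
          show ?case using 5(5) t1 u by simp
        qed (simp_all add: n3 vars)
      qed (auto simp: v2 v2')
    qed auto
  qed
qed

section \<open>Invariants and running time of the main loops\<close>

text \<open>Below, \<open>D\<close> are the pairs of end vertices and \<open>Q\<close> the edges for the current pair that the
  program has dealt with.\<close>

definition listed :: "'k::field store \<Rightarrow> bool" where
  "listed s \<longleftrightarrow> (\<forall>t<out_dim s. inj_on (out_path s t) {..<out_len s t} \<and> (\<forall>r<out_len s t. out_coef s t r \<noteq> 0))"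

abbreviation outs :: "'k::field store \<Rightarrow> (nat list \<Rightarrow>\<^sub>0 'k) set" where
  "outs s \<equiv> out_elem s ` {..<out_dim s}"

definition paths_over :: "nat pair_pre_digraph \<Rightarrow> (nat \<times> nat) set \<Rightarrow> nat list set" where
  "paths_over H D = {[a, b, c, d] | a b c d. (a, d) \<in> D \<and> [a, b, c, d] \<in> allowed_paths 3 H}"

definition pairs_done :: "nat pair_pre_digraph \<Rightarrow> nat \<Rightarrow> (nat \<times> nat) set \<Rightarrow> 'k::field store \<Rightarrow> bool" where
  "pairs_done H n D s \<longleftrightarrow> listed s \<and> (\<exists>piv. pivoted H (paths_over H D) (out_dim s) (out_elem s) piv) \<and>
     (\<forall>(a, d)\<in>D. end_pair.settled H n a d (outs s))"

text \<open>The pivots exist in the proof only, not in the store. That they avoid the tree edges is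
  required for the current pair alone: the tree starts empty, and \<open>pairs_done\<close> forgets
  it.\<close>

definition edges_done :: "nat pair_pre_digraph \<Rightarrow> nat \<Rightarrow> (nat \<times> nat) set \<Rightarrow> nat \<Rightarrow> nat \<Rightarrow> (nat \<times> nat) set \<Rightarrow> 'k::field store \<Rightarrow> bool" where
  "edges_done H n D a d Q s \<longleftrightarrow> listed s \<and>
     (\<exists>piv. pivoted H (paths_over H D \<union> (\<lambda>(b, c). [a, b, c, d]) ` Q) (out_dim s) (out_elem s) piv \<and>
       (\<forall>j<ncell s ''nt'' []. \<forall>t<out_dim s. piv t \<noteq> [a, ncell s ''tb'' [j], ncell s ''tc'' [j], d])) \<and>
     (\<forall>(a', d')\<in>D. end_pair.settled H n a' d' (outs s)) \<and>
     end_pair.forest H n a d Q (outs s) (ncell s ''nt'' []) (\<lambda>x. ncell s ''lab'' [x]) (\<lambda>x j. kcell s ''P'' [x, j])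
       (\<lambda>j. ncell s ''tb'' [j]) (\<lambda>j. ncell s ''tc'' [j])"

lemma edges_doneI:
  assumes "listed s" "pivoted H (paths_over H D \<union> (\<lambda>(b, c). [a, b, c, d]) ` Q) (out_dim s) (out_elem s) piv"
    and "\<And>j t. j < ncell s ''nt'' [] \<Longrightarrow> t < out_dim s \<Longrightarrow> piv t \<noteq> [a, ncell s ''tb'' [j], ncell s ''tc'' [j], d]"
    and "\<And>a' d'. (a', d') \<in> D \<Longrightarrow> end_pair.settled H n a' d' (outs s)"
    and "end_pair.forest H n a d Q (outs s) (ncell s ''nt'' []) (\<lambda>x. ncell s ''lab'' [x]) (\<lambda>x j. kcell s ''P'' [x, j])
       (\<lambda>j. ncell s ''tb'' [j]) (\<lambda>j. ncell s ''tc'' [j])"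
  shows "edges_done H n D a d Q s"
  unfolding edges_done_def using assms by (intro conjI) auto

text \<open>Amortized bound: an edge costs \<open>300 * (n + 1)\<close>, and a merge pays its larger
  cost from the credit \<open>300 * (n + 1) * (n + 1)\<close> released when \<open>nt\<close>
  increases.\<close>

lemma wp_edge:
  fixes s :: "'k::field store"
  assumes H: "pair_loopfree_digraph H" and verts: "pverts H = {..<n}"
    and s: "static H n s" and vars: "ncell s ''a'' [] = a" "ncell s ''b'' [] = b" "ncell s ''c'' [] = c" "ncell s ''d'' [] = d"
    and bc: "b < n" "c < n" and ad: "(a, d) \<notin> D" and bcQ: "(b, c) \<notin> Q" and I: "edges_done H n D a d Q s"
    and R: "\<And>s' t. frame (nmod edge_c) (kmod edge_c) s s' \<Longrightarrow>
      edges_done H n D a d (if end_pair.edge H a d b c then insert (b, c) Q else Q) s' \<Longrightarrow>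
      t + ncell s ''nt'' [] * (300 * (n + 1) * (n + 1)) \<le> ncell s' ''nt'' [] * (300 * (n + 1) * (n + 1)) + 300 * (n + 1) \<Longrightarrow> R s' t"
  shows "wp edge_c R s"
proof -
  have ep: "end_pair H n" using H verts by (simp add: end_pair_def)
  define nt where "nt = ncell s ''nt'' []"
  define dm where "dm = out_dim s"
  let ?W = "outs s" and ?lab = "\<lambda>x. ncell s ''lab'' [x]" and ?P = "\<lambda>x j. kcell s ''P'' [x, j]"
    and ?tb = "\<lambda>j. ncell s ''tb'' [j]" and ?tc = "\<lambda>j. ncell s ''tc'' [j]"
  let ?R = "paths_over H D \<union> (\<lambda>(b, c). [a, b, c, d]) ` Q"
  from I obtain piv where I1: "listed s" and I2: "pivoted H ?R dm (out_elem s) piv"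
    and I3: "\<And>j t. j < nt \<Longrightarrow> t < dm \<Longrightarrow> piv t \<noteq> [a, ?tb j, ?tc j, d]"
    and I4: "\<And>a' d'. (a', d') \<in> D \<Longrightarrow> end_pair.settled H n a' d' ?W"
    and F: "end_pair.forest H n a d Q ?W nt ?lab ?P ?tb ?tc"
    unfolding edges_done_def nt_def[symmetric] dm_def[symmetric] by (elim conjE exE) blast
  have adj: "ncell s ''adj'' [u, v] = (if (u, v) \<in> parcs H then 1 else 0)" for u v
    using s by (simp add: static_def)
  have off: "ncell s ''off'' [c] = n + c" using s bc by (simp add: static_def)
  have nt: "nt \<le> 2 * n" by (rule end_pair.forest_nt[OF ep F])
  have eR: "[a, b, c, d] \<notin> ?R" using ad bcQ by (auto simp: paths_over_def)
  show ?thesis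
    unfolding edge_c_def
  proof (rule wp_Cond, goal_cases)
    case 1
    then have e: "end_pair.edge H a d b c"
      by (simp add: vars adj end_pair.edge_def[OF ep] split: if_splits)
    show ?case
    proof (rule wp_Cond, goal_cases)
      case 1
      then have lab: "?lab b = ?lab (n + c)" by (simp add: vars off)
      define T where "T j = [a, ?tb j, ?tc j, d]" for j
      define Df where "Df j = ?P (n + c) j - ?P b j" for j
      have injT: "inj_on T {..<nt}"
        using end_pair.forestD(6)[OF ep F] by (auto simp: inj_on_def T_def)
      have TQ: "(?tb j, ?tc j) \<in> Q" if "j < nt" for j using end_pair.forestD(5)[OF ep F that] .
      have eT: "[a, b, c, d] \<notin> T ` {..<nt}"
      proof
        assume "[a, b, c, d] \<in> T ` {..<nt}"
        then obtain j where "j < nt" "?tb j = b" "?tc j = c" by (auto simp: T_def)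
        then show False using TQ[of j] bcQ by simp
      qed
      show ?case
      proof (rule wp_emit[where nt = nt and dm = dm and T = T and D = Df and H = H and n = n and a = a and b = b and c = c and d = d], goal_cases)
        case (13 s' t)
        note fr = 13(1)
        have n': "\<And>x. x \<notin> nmod emit_c \<Longrightarrow> ncell s' x = ncell s x" and k': "\<And>x. x \<notin> kmod emit_c \<Longrightarrow> kcell s' x = kcell s x"
          using fr by (auto simp: frame_def)
        have o': "out_elem s' u = out_elem s u" if "u < dm" for u
          using 13(5)[of u] that by (simp add: out_elem_def)
        have W': "outs s' = insert (out_elem s' dm) ?W"
          using o' 13(6) by (auto simp: dm_def[symmetric] lessThan_Suc)
        have sp: "pv.span ?W \<subseteq> pv.span (outs s')" unfolding W' by (rule pv.span_mono) auto
        have z: "out_elem s' dm = el [a, b, c, d] - end_pair.pot a d nt ?tb ?tc ?P b + end_pair.pot a d nt ?tb ?tc ?P (n + c)"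
          unfolding 13(2) by (simp add: end_pair.pot_def[OF ep] Df_def T_def pv.scale_left_diff_distrib sum_subtractf)
        have p': "pivoted H (insert [a, b, c, d] ?R) (Suc dm) (out_elem s') (piv(dm := [a, b, c, d]))"
          using end_pair.pivoted_emit[OF ep F e lab I2 eR _ I3 o' z] by blast
        have t': "(piv(dm := [a, b, c, d])) t \<noteq> [a, ?tb j, ?tc j, d]" if "j < nt" "t < Suc dm" for j t
          using I3[OF that(1), of t] that eT by (auto simp: T_def less_Suc_eq)
        have l': "listed s'"
          using I1 13(3-6) unfolding listed_def dm_def[symmetric] by (auto simp: less_Suc_eq)
        have s': "end_pair.settled H n a' d' (outs s')" if "(a', d') \<in> D" for a' d'
          using end_pair.settled_mono[OF ep I4[OF that] sp] .
        have f': "end_pair.forest H n a d (insert (b, c) Q) (outs s') nt ?lab ?P ?tb ?tc"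
        proof -
          have "end_pair.forest H n a d Q (outs s') nt ?lab ?P ?tb ?tc"
            by (rule end_pair.forest_span_mono[OF ep F sp])
          moreover have "el [a, b, c, d] - end_pair.pot a d nt ?tb ?tc ?P b + end_pair.pot a d nt ?tb ?tc ?P (n + c) \<in> pv.span (outs s')"
            unfolding z[symmetric] W' by (intro pv.span_base) simp
          ultimately show ?thesis
            unfolding end_pair.forest_def[OF ep] using e lab by auto
        qed
        have "edges_done H n D a d (insert (b, c) Q) s'"
          by (rule edges_doneI[OF l', where piv = "piv(dm := [a, b, c, d])"])
            (use p' t' s' f' in \<open>simp_all add: n' k' nt_def[symmetric] 13(6) del: fun_upd_apply\<close>)
        then show ?case
          using e 13(7) nt by (intro R) (use fr in \<open>auto simp: frame_def n' nt_def[symmetric]\<close>)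
      qed (use s vars bc injT eT in \<open>auto simp: nt_def dm_def out_dim_def T_def Df_def\<close>)
    next
      case 2
      then have lab: "?lab b \<noteq> ?lab (n + c)" by (simp add: vars off)
      show ?case
      proof (rule wp_merge[where nt = nt and H = H and n = n and b = b and c = c], goal_cases)
        case (8 s' t p q sg)
        note fr = 8(1)
        have n': "\<And>x. x \<notin> nmod merge_c \<Longrightarrow> ncell s' x = ncell s x" and k': "\<And>x. x \<notin> kmod merge_c \<Longrightarrow> kcell s' x = kcell s x"
          using fr by (auto simp: frame_def)
        have o': "out_elem s' = out_elem s" "out_dim s' = out_dim s" "out_len s' = out_len s" "out_path s' = out_path s" "out_coef s' = out_coef s"
          by (auto simp: out_elem_def out_dim_def out_len_def out_path_def out_coef_def n' k' fun_eq_iff)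
        have f': "end_pair.forest H n a d (insert (b, c) Q) ?W (Suc nt) (\<lambda>x. ncell s' ''lab'' [x]) (\<lambda>x j. kcell s' ''P'' [x, j])
            (\<lambda>j. ncell s' ''tb'' [j]) (\<lambda>j. ncell s' ''tc'' [j])"
          by (rule end_pair.forest_merge[OF ep F e bcQ 8(2-10)])
        have p': "pivoted H (paths_over H D \<union> (\<lambda>(b, c). [a, b, c, d]) ` insert (b, c) Q) dm (out_elem s) piv"
          using I2 unfolding pivoted_def by auto
        have t': "piv t \<noteq> [a, ncell s' ''tb'' [j], ncell s' ''tc'' [j], d]" if "j < Suc nt" "t < dm" for j t
        proof (cases "j = nt")
          case True
          \<comment> \<open>Pivots are edges treated before, whereas the new tree edge is
            not.\<close>
          have "piv t \<in> ?R" using I2 that(2) unfolding pivoted_def by blast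
          then show ?thesis using True 8(9,10) eR by auto
        next
          case False
          then show ?thesis using 8(8)[of j] I3[of j t] that by auto
        qed
        have "edges_done H n D a d (insert (b, c) Q) s'"
          by (rule edges_doneI[where piv = piv])
            (use I1 I4 p' t' f' in \<open>simp_all only: listed_def 8(11) o' dm_def not_False_eq_True\<close>)
        \<comment> \<open>With \<open>nt <= 2 * n\<close>, a merge rewrites at most
          \<open>2 * n\<close> rows of at most \<open>2 * n + 1\<close> entries.\<close>
        moreover have "2 * n * (20 * nt + 60) + 40 * nt + 250 \<le> 300 * (n + 1) * (n + 1)"
        proof -
          have "2 * n * (20 * nt + 60) \<le> 2 * n * (20 * (2 * n) + 60)"
            using nt by (intro mult_left_mono add_right_mono) auto
          then have "2 * n * (20 * nt + 60) + 40 * nt + 250 \<le> 2 * n * (20 * (2 * n) + 60) + 40 * (2 * n) + 250"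
            using nt by linarith
          also have "\<dots> \<le> 300 * (n + 1) * (n + 1)" by (simp add: algebra_simps)
          finally show ?thesis .
        qed
        ultimately show ?case
          using e 8(11,12) by (intro R) (use fr in \<open>auto simp: frame_def nt_def[symmetric]\<close>)
      qed (use s vars bc lab in \<open>auto simp: nt_def\<close>)
    qed
  next
    case 2
    then have "\<not> end_pair.edge H a d b c"
      by (simp add: vars adj end_pair.edge_def[OF ep] split: if_splits)
    then show ?case
      using I by (intro wp_Skip R) (auto simp: frame_refl)
  qed
qed

lemma out_frame:
  assumes "frame N K s s'" "N \<inter> {''len'', ''dim'', ''vert''} = {}" "''coef'' \<notin> K"
  shows "out_dim s' = out_dim s" "out_len s' = out_len s" "out_coef s' = out_coef s"
    "out_path s' = out_path s" "out_elem s' = out_elem s"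
proof -
  have "ncell s' a = ncell s a" if "a \<in> {''len'', ''dim'', ''vert''}" for a
    using assms that by (intro frame_ncell[OF assms(1)]) blast
  moreover have "kcell s' ''coef'' = kcell s ''coef''"
    by (rule frame_kcell[OF assms(1,3)])
  ultimately show "out_dim s' = out_dim s" "out_len s' = out_len s" "out_coef s' = out_coef s"
    "out_path s' = out_path s" "out_elem s' = out_elem s"
    by (simp_all add: out_elem_def out_dim_def out_len_def out_path_def out_coef_def fun_eq_iff)
qed

lemma frame_nset: "frame {i} {} s (nset i is x s)"
  by (simp add: frame_def)

lemma edges_done_nset:
  assumes "i \<notin> {''len'', ''dim'', ''vert'', ''nt'', ''lab'', ''tb'', ''tc''}"
  shows "edges_done H n D a d Q (nset i [] k s) = edges_done H n D a d Q s"
proof -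
  have n: "ncell (nset i [] k s) a = ncell s a" if "a \<in> {''nt'', ''lab'', ''tb'', ''tc''}" for a
    using assms that by (intro frame_ncell[OF frame_nset]) blast
  have "{i} \<inter> {''len'', ''dim'', ''vert''} = {}" "''coef'' \<notin> {}" using assms by auto
  note o = out_frame[OF frame_nset[of i s "[]" k] this]
  show ?thesis
    unfolding edges_done_def listed_def o kcell_nset
    using n[of "''nt''"] n[of "''lab''"] n[of "''tb''"] n[of "''tc''"] by (simp only: insert_iff simp_thms)
qed

lemma pairs_done_nset:
  assumes "i \<notin> {''len'', ''dim'', ''vert''}"
  shows "pairs_done H n D (nset i [] k s) = pairs_done H n D s"
proof -
  have "{i} \<inter> {''len'', ''dim'', ''vert''} = {}" "''coef'' \<notin> {}" using assms by auto
  note o = out_frame[OF frame_nset[of i s "[]" k] this]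
  show ?thesis unfolding pairs_done_def listed_def o ..
qed

lemma mod_pair_c [simp]: "nmod pair_c = insert ''b'' (insert ''c'' (nmod label_c \<union> nmod edge_c))"
  "kmod pair_c = kmod edge_c"
  by (auto simp: pair_c_def)

text \<open>The credit spent on merges is bounded only once, at the end, by
  \<open>nt <= 2 * n\<close>: this gives \<open>2 * n * M\<close>, cubic in \<open>n\<close>, as are
  the \<open>n * n\<close> edges at linear cost each.\<close>

lemma wp_pair:
  fixes s :: "'k::field store"
  assumes H: "pair_loopfree_digraph H" and verts: "pverts H = {..<n}"
    and s: "static H n s" and vars: "ncell s ''a'' [] = a" "ncell s ''d'' [] = d"
    and ad: "(a, d) \<notin> D" and I: "pairs_done H n D s"
    and R: "\<And>s' t. frame (nmod pair_c) (kmod pair_c) s s' \<Longrightarrow> pairs_done H n (insert (a, d) D) s' \<Longrightarrow>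
      t \<le> 1200 * (n + 1) ^ 3 \<Longrightarrow> R s' t"
  shows "wp pair_c R s"
proof -
  have ep: "end_pair H n" using H verts by (simp add: end_pair_def)
  \<comment> \<open>The edges lexicographically before \<open>(b, c)\<close>. A finished row is the
    start of the next one because edges satisfy \<open>c < n\<close>.\<close>
  define Q where "Q b c = {(b', c'). end_pair.edge H a d b' c' \<and> (b' < b \<or> b' = b \<and> c' < c)}" for b c
  have Qn: "Q b n = Q (Suc b) 0" for b
    using end_pair.edge_less[OF ep] by (auto simp: Q_def less_Suc_eq)
  have Qc: "Q b (Suc c) = (if end_pair.edge H a d b c then insert (b, c) (Q b c) else Q b c)" for b c
    by (auto simp: Q_def less_Suc_eq)
  define M where "M = 300 * (n + 1) * (n + 1)"
  define E where "E = 300 * (n + 1)"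
  show ?thesis
    unfolding pair_c_def
  proof (rule wp_Seq, rule wp_label[OF ep s vars], goal_cases)
    case (1 s1 t1)
    note o1 = out_frame[OF 1(1), simplified]
    have st1: "static H n s1" using s static_frame[OF 1(1)] by simp
    have v1: "ncell s1 ''a'' [] = a" "ncell s1 ''d'' [] = d" using 1(1) vars by (auto simp: frame_def)
    obtain piv where "pivoted H (paths_over H D) (out_dim s) (out_elem s) piv"
      using I unfolding pairs_done_def by blast
    then have "edges_done H n D a d {} s1"
      using I 1(3) end_pair.forest_init[OF ep, where lab = "\<lambda>x. ncell s1 ''lab'' [x]", OF 1(2)]
      by (intro edges_doneI[where piv = piv]) (auto simp: o1 pairs_done_def listed_def)
    then have e1: "edges_done H n D a d (Q 0 0) s1" by (simp add: Q_def)
    show ?case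
    proof (rule wp_For[where N = n and I = "\<lambda>k s' t. edges_done H n D a d (Q k 0) s' \<and>
        t \<le> k * (n * (E + 10) + 20) + ncell s' ''nt'' [] * M"], goal_cases)
      case 1
      show ?case by simp
    next
      case (2 s')
      then show ?case using st1 by (simp add: frame_def static_def)
    next
      case 3
      show ?case using e1 by (simp add: edges_done_nset)
    next
      case (4 b s2 t2)
      have st2: "static H n s2" using st1 static_frame[OF 4(2)] by simp
      have v2: "ncell s2 ''a'' [] = a" "ncell s2 ''d'' [] = d" "ncell s2 ''b'' [] = b" using 4(2,3) v1 by (auto simp: frame_def)
      show ?case
      \<comment> \<open>Only merges within this row are charged here, so the credit spent before it
        stands on the left.\<close>
      proof (rule wp_For[where N = n and I = "\<lambda>c s' t. edges_done H n D a d (Q b c) s' \<and>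
          t + ncell s2 ''nt'' [] * M \<le> c * (E + 10) + ncell s' ''nt'' [] * M"], goal_cases)
        case 1
        show ?case by simp
      next
        case (2 s')
        then show ?case using st2 by (simp add: frame_def static_def)
      next
        case 3
        show ?case using 4(4) by (simp add: edges_done_nset)
      next
        case (4 c s3 t3)
        have st3: "static H n s3" using st2 static_frame[OF 4(2)] by simp
        have v3: "ncell s3 ''a'' [] = a" "ncell s3 ''b'' [] = b" "ncell s3 ''c'' [] = c" "ncell s3 ''d'' [] = d"
          using 4(2,3) v2 by (auto simp: frame_def)
        have bcQ: "(b, c) \<notin> Q b c" by (simp add: Q_def)
        have e3: "edges_done H n D a d (Q b c) s3" using 4(4) by blast
        show ?case
        proof (rule wp_edge[OF H verts st3 v3 \<open>b < n\<close> \<open>c < n\<close> ad bcQ e3], goal_cases)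
          case (1 s4 t4)
          then show ?case
            using 4(4) 1(3)[folded M_def E_def] by (auto simp: Qc edges_done_nset)
        qed
      next
        case (5 s3 t3)
        then show ?case using 4(4) by (auto simp: edges_done_nset Qn)
      qed
    next
      case (5 s2 t2)
      have e2: "edges_done H n D a d (Q n 0) s2" using 5(2) by blast
      then have F: "end_pair.forest H n a d (Q n 0) (outs s2) (ncell s2 ''nt'' []) (\<lambda>x. ncell s2 ''lab'' [x]) (\<lambda>x j. kcell s2 ''P'' [x, j])
         (\<lambda>j. ncell s2 ''tb'' [j]) (\<lambda>j. ncell s2 ''tc'' [j])"
        unfolding edges_done_def by (elim conjE)
      have "paths_over H D \<union> (\<lambda>(b, c). [a, b, c, d]) ` Q n 0 = paths_over H (insert (a, d) D)"
        using end_pair.edge_less[OF ep] by (auto simp: paths_over_def Q_def end_pair.edge_allowed[OF ep] image_iff)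
      moreover have "end_pair.settled H n a d (outs s2)"
        by (rule end_pair.forest_settled[OF ep F]) (use end_pair.edge_less[OF ep] in \<open>auto simp: Q_def\<close>)
      ultimately have "pairs_done H n (insert (a, d) D) s2"
        using e2 unfolding edges_done_def pairs_done_def by auto
      moreover have "frame (nmod pair_c) (kmod pair_c) s s2"
        using 1(1) 5(1) by (auto simp: frame_def)
      moreover have "t1 + (t2 + 7) \<le> 1200 * (n + 1) ^ 3"
      proof -
        have "ncell s2 ''nt'' [] * M \<le> 2 * n * M"
          by (rule mult_right_mono[OF end_pair.forest_nt[OF ep F]]) simp
        then have "t1 + (t2 + 7) \<le> 60 * n + 20 + (n * (n * (E + 10) + 20) + 2 * n * M + 7)"
          using 1(4) 5(2) by linarith
        also have "\<dots> \<le> 1200 * (n + 1) ^ 3"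
          by (simp add: M_def E_def power3_eq_cube algebra_simps)
        finally show ?thesis .
      qed
      ultimately show ?case by (intro R) simp_all
    qed
  qed
qed

lemma wp_Omega3:
  fixes R :: "'k::field store \<Rightarrow> nat \<Rightarrow> bool"
  assumes H: "pair_loopfree_digraph H" and verts: "pverts H = {..<n}"
    and R: "\<And>s' t. outputs_basis s' (Omega 3 H) \<Longrightarrow> t \<le> 2000 * (n + 1) ^ 5 \<Longrightarrow> R s' t"
  shows "wp Omega3_c R (input_store n H)"
proof -
  let ?s = "input_store n H :: 'k store"
  have ep: "end_pair H n" using H verts by (simp add: end_pair_def)
  \<comment> \<open>The pairs lexicographically before \<open>(a, d)\<close>; the bound
    \<open>d' < n\<close> makes the end of a row coincide with the start of the next.\<close>
  define D where "D a d = {(a', d'). d' < n \<and> (a' < a \<or> a' = a \<and> d' < d)}" for a d :: nat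
  have Dn: "D a n = D (Suc a) 0" for a by (auto simp: D_def less_Suc_eq)
  have Dc: "D a (Suc d) = insert (a, d) (D a d)" if "d < n" for a d using that by (auto simp: D_def less_Suc_eq)
  define B where "B = 1200 * (n + 1) ^ 3 + 10"
  show ?thesis
    unfolding Omega3_c_def
  proof (rule wp_Seq, rule wp_setup[where n = n and H = H], goal_cases)
    case (3 s1 t1)
    \<comment> \<open>The program does not initialise \<open>dim\<close>; it relies on unset cells
      being 0.\<close>
    have "ncell s1 ''dim'' [] = 0" using 3(1) by (simp add: frame_def input_store_def)
    then have p1: "pairs_done H n (D 0 0) s1"
      by (auto simp: pairs_done_def listed_def out_dim_def pivoted_def D_def)
    show ?case
    proof (rule wp_For[where N = n and I = "\<lambda>k s' t. pairs_done H n (D k 0) s' \<and> t \<le> k * (n * B + 20)"], goal_cases)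
      case 1
      show ?case by simp
    next
      case (2 s')
      then show ?case using 3(2) by (simp add: frame_def static_def)
    next
      case 3
      show ?case using p1 by (simp add: pairs_done_nset)
    next
      case (4 a s2 t2)
      have st2: "static H n s2" using 3(2) static_frame[OF 4(2)] by simp
      show ?case
      proof (rule wp_For[where N = n and I = "\<lambda>d s' t. pairs_done H n (D a d) s' \<and> t \<le> d * B"], goal_cases)
        case 1
        show ?case by simp
      next
        case (2 s')
        then show ?case using st2 by (simp add: frame_def static_def)
      next
        case 3
        show ?case using 4(4) by (simp add: pairs_done_nset)
      next
        case (4 d s3 t3)
        have st3: "static H n s3" using st2 static_frame[OF 4(2)] by simp
        have v3: "ncell s3 ''a'' [] = a" "ncell s3 ''d'' [] = d"
          using 4(2,3) \<open>ncell s2 ''a'' [] = a\<close> by (auto simp: frame_def)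
        have ad: "(a, d) \<notin> D a d" by (simp add: D_def)
        have p3: "pairs_done H n (D a d) s3" using 4(4) by blast
        show ?case
        proof (rule wp_pair[OF H verts st3 v3 ad p3], goal_cases)
          case (1 s4 t4)
          then show ?case
            using 4(1,4) by (auto simp: Dc pairs_done_nset B_def)
        qed
      next
        case (5 s3 t3)
        then show ?case using 4(4) by (auto simp: pairs_done_nset Dn)
      qed
    next
      case (5 s2 t2)
      have p: "pairs_done H n (D n 0) s2" using 5(2) by blast
      then obtain piv where piv: "pivoted H (paths_over H (D n 0)) (out_dim s2) (out_elem s2) piv"
        unfolding pairs_done_def by blast
      have se: "end_pair.settled H n a d (outs s2)" if "a < n" "d < n" for a d
        using p that unfolding pairs_done_def D_def by auto
      have "outputs_basis s2 (Omega 3 H)"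
        using settled_pivoted_basis[OF H verts piv se] p
        unfolding outputs_basis_def pairs_done_def listed_def by auto
      moreover have "t1 + (t2 + 7) \<le> 2000 * (n + 1) ^ 5"
      proof -
        have "t1 + (t2 + 7) \<le> 20 * n + 20 + n * (n * B + 20) + 7"
          using 3(3) 5(2) by linarith
        also have "\<dots> \<le> 2000 * (n + 1) ^ 5"
        proof -
          define N where "N = n + 1"
          have N1: "1 \<le> N ^ k" for k by (simp add: N_def)
          have N45: "N * N ^ 3 = N ^ 4" "N * N ^ 4 = N ^ 5" by (simp_all add: numeral_eq_Suc)
          have "B \<le> 1210 * N ^ 3" using N1[of 3] unfolding B_def N_def[symmetric] by linarith
          then have "n * B \<le> N * (1210 * N ^ 3)" by (intro mult_mono) (auto simp: N_def)
          then have "n * B + 20 \<le> 1230 * N ^ 4" using N1[of 4] N45 by linarith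
          then have "n * (n * B + 20) \<le> N * (1230 * N ^ 4)" by (intro mult_mono) (auto simp: N_def)
          moreover have "n \<le> N ^ 5"
            using self_le_power[of N 5] by (simp add: N_def)
          ultimately show ?thesis using N1[of 5] N45 unfolding N_def[symmetric] by linarith
        qed
        finally show ?thesis .
      qed
      ultimately show ?case by (intro R) simp_all
    qed
  qed (auto simp: input_store_def)
qed

theorem theorem1p1:
  fixes G :: "'v pair_pre_digraph"
  assumes "pair_loopfree_digraph G"
  shows "(\<exists>B :: ('v list \<Rightarrow>\<^sub>0 'k::field) set. B \<subseteq> merging_images G \<and> is_basis B (Omega 3 G)) \<and>
    (\<exists>(prog :: com) (T :: nat \<Rightarrow> nat).
       (\<lambda>n. real (T n)) \<in> O(\<lambda>n. real n ^ 5) \<and>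
       (\<forall>(n :: nat) (H :: nat pair_pre_digraph). pair_digraph H \<and> pverts H = {..<n} \<longrightarrow>
          (\<exists>t (s :: 'k store). exec prog (input_store n H) t s \<and> t \<le> T n \<and>
             outputs_basis s (Omega 3 H))))"
proof (intro conjI exI[of _ Omega3_c] exI[of _ "\<lambda>n. 2000 * (n + 1) ^ 5"] allI impI)
  show "\<exists>B :: ('v list \<Rightarrow>\<^sub>0 'k) set. B \<subseteq> merging_images G \<and> is_basis B (Omega 3 G)"
    by (rule Omega3_basis_of_merging_images[OF assms])
  show "(\<lambda>n. real (2000 * (n + 1) ^ 5)) \<in> O(\<lambda>n. real n ^ 5)"
  proof (rule bigoI[where c = "2000 * 2 ^ 5"], rule eventually_mono[OF eventually_ge_at_top[of 1]])
    fix n :: nat assume "1 \<le> n"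
    then have "real (n + 1) ^ 5 \<le> (2 * real n) ^ 5" by (intro power_mono) auto
    then show "norm (real (2000 * (n + 1) ^ 5)) \<le> 2000 * 2 ^ 5 * norm (real n ^ 5)"
      by (simp add: power_mult_distrib)
  qed
  fix n :: nat and H :: "nat pair_pre_digraph"
  assume H: "pair_digraph H \<and> pverts H = {..<n}"
  then have "pair_loopfree_digraph H" by (simp add: pair_digraph_def)
  then have "wp Omega3_c (\<lambda>s t. t \<le> 2000 * (n + 1) ^ 5 \<and> outputs_basis s (Omega 3 H)) (input_store n H :: 'k store)"
    using H by (intro wp_Omega3) auto
  then show "\<exists>t (s :: 'k store). exec Omega3_c (input_store n H) t s \<and> t \<le> 2000 * (n + 1) ^ 5 \<and>
      outputs_basis s (Omega 3 H)"
    unfolding wp_def by blast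
qed

end
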